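(* For every $\theta\in\mathscr{H}$ and $F\in\mathbf{P}$, $$\int_{\mathscr{W}}F(w+\theta)\,\gamma(dw)=E\big[e^{D_\theta}F\big]=E\big[F\cdot e^{D_\theta^{*}}1\big]=\int_{\mathscr{W}}F(w)\exp\Big\{\int_0^1\dot\theta(t)\,dw(t)-\frac12\int_0^1\dot\theta(t)^2\,dt\Big\}\gamma(dw).$$
   Context: $(\mathscr{W},\mathscr{B}(\mathscr{W}),\gamma)$ is the Wiener space: $\mathscr{W}$ is the set of continuous paths $w:[0,1]\to\mathbb{R}$ with $w(0)=0$, with the $\sigma$-field generated by the topology of uniform convergence, and $\gamma$ is Wiener measure; $E$ is expectation under $\gamma$. $\mathscr{H}\subset\mathscr{W}$ is the Cameron-Martin space of absolutely continuous $h$ with square-integrable derivative $\dot h$, with inner product $\langle h_1,h_2\rangle_{\mathscr{H}}=\int_0^1\dot h_1(t)\dot h_2(t)\,dt$. For $h\in\mathscr{H}$, $[h](w):=\int_0^1\dot h(t)\,dw(t)$ (Wiener integral), with the convention $[h](w+\theta)=[h](w)+\langle h,\theta\rangle_{\mathscr{H}}$ for $\theta\in\mathscr{H}$. $\mathbf{P}$ is the algebra of polynomial functionals $F(w)=p([h_1](w),\dots,[h_n](w))$, with $n\in\mathbb{N}$, $h_i\in\mathscr{H}$, $p$ a real polynomial in $n$ variables. For $\theta\in\mathscr{H}$, $D_\theta F(w)=\lim_{\varepsilon\to0}\frac1\varepsilon\{F(w+\varepsilon\theta)-F(w)\}$ and $D_\theta^{*}F(w):=-D_\theta F(w)+[\theta](w)F(w)$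 for $F\in\mathbf{P}$. The exponentials are $e^{D_\theta}F:=\sum_{n\ge0}\frac1{n!}D_\theta^nF$ for $F\in\mathbf{P}$ (a finite sum), and the formal series $e^{D_\theta^{*}}:=\sum_{n\ge0}\frac1{n!}(D_\theta^{*})^n$. *)

theory Defs
  imports "HOL-Probability.Probability"
begin

section \<open>Wiener space\<close>

text \<open>
  A path on [0,1] is represented by its extension to the real line that is constant on
  (-\<infinity>,0] and on [1,\<infinity>). This identifies the continuous paths on [0,1] started at 0 with a
  closed linear subspace of the bounded continuous functions on the line, isometrically for
  the sup norms, so that the library topology of the type is the one of uniform convergence.
\<close>

type_synonym path = "real \<Rightarrow>\<^sub>C real"

definition wiener_space :: "path set" where
  "wiener_space = {w :: path. w 0 = 0 \<and> (\<forall>t\<le>0. w t = w 0) \<and> (\<forall>t\<ge>1. w t = w 1)}"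

definition time_grid :: "nat \<Rightarrow> (nat \<Rightarrow> real) \<Rightarrow> bool" where
  "time_grid n t \<longleftrightarrow> 0 \<le> t 0 \<and> (\<forall>i<n. t i < t (Suc i)) \<and> t n \<le> 1"

text \<open>
  Wiener measure is the Borel probability measure on the Wiener space whose coordinate process
  is a Brownian motion; by separability it is determined by the law of the increments. Recall that
  the second parameter of \<^const>\<open>normal_density\<close> is the standard deviation.
\<close>

definition wiener_measure :: "path measure \<Rightarrow> bool" where
  "wiener_measure \<gamma> \<longleftrightarrow>
     prob_space \<gamma> \<and>
     sets \<gamma> = sets (restrict_space borel wiener_space) \<and>
     (\<forall>s t. 0 \<le> s \<and> s < t \<and> t \<le> 1 \<longrightarrow>
        distributed \<gamma> lborel (\<lambda>w::path. w t - w s) (normal_density 0 (sqrt (t - s)))) \<and>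
     (\<forall>n t. time_grid n t \<longrightarrow>
        prob_space.indep_vars \<gamma> (\<lambda>_. borel) (\<lambda>i (w::path). w (t (Suc i)) - w (t i)) {..<n})"


section \<open>The Cameron-Martin space\<close>

definition absolutely_continuous_path :: "(real \<Rightarrow> real) \<Rightarrow> bool" where
  "absolutely_continuous_path h \<longleftrightarrow>
     (\<forall>\<epsilon>>0. \<exists>\<delta>>0. \<forall>(n::nat) a b.
        (\<forall>i<n. 0 \<le> a i \<and> a i \<le> b i \<and> b i \<le> 1) \<and>
        disjoint_family_on (\<lambda>i. {a i<..<b i}) {..<n} \<and>
        (\<Sum>i<n. b i - a i) < \<delta> \<longrightarrow>
        (\<Sum>i<n. \<bar>h (b i) - h (a i)\<bar>) < \<epsilon>)"

text \<open>
  The derivative of \<open>h\<close> is rendered by \<^term>\<open>deriv h\<close>, which is an unspecified number at points of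
  non-differentiability. For an absolutely continuous function these points form a null set, and
  the derivative is measurable, by Lebesgue's theorem. Both facts are listed in the definition
  so that \<^term>\<open>deriv h\<close> is meaningful without appeal to that theorem; they exclude no path.
\<close>

definition cameron_martin :: "path set" where
  "cameron_martin = {h \<in> wiener_space.
     absolutely_continuous_path h \<and>
     (AE t in lebesgue_on {0..1}. h field_differentiable (at t)) \<and>
     deriv h \<in> borel_measurable (lebesgue_on {0..1}) \<and>
     integrable (lebesgue_on {0..1}) (\<lambda>t. (deriv h t)\<^sup>2)}"

definition cm_inner :: "path \<Rightarrow> path \<Rightarrow> real" where
  "cm_inner h1 h2 = (\<integral>t. deriv h1 t * deriv h2 t \<partial>lebesgue_on {0..1})"


section \<open>The Wiener integral\<close>

definition step_function :: "nat \<Rightarrow> (nat \<Rightarrow> real) \<Rightarrow> (nat \<Rightarrow> real) \<Rightarrow> real \<Rightarrow> real" where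
  "step_function n t c x = (\<Sum>i<n. c i * indicator {t i<..t (Suc i)} x)"

definition step_integral :: "nat \<Rightarrow> (nat \<Rightarrow> real) \<Rightarrow> (nat \<Rightarrow> real) \<Rightarrow> path \<Rightarrow> real" where
  "step_integral n t c w = (\<Sum>i<n. c i * (w (t (Suc i)) - w (t i)))"

text \<open>
  \<open>X\<close> is a version of the Wiener integral of the derivative of \<open>h\<close>: the limit in \<open>L\<^sup>2(\<gamma>)\<close>
  of the integrals of step functions converging to that derivative in \<open>L\<^sup>2[0,1]\<close>. By the Ito isometry
  the limit does not depend on the approximating sequence. Random variables are only required
  to be measurable for the completion of \<open>\<gamma>\<close>.
\<close>

definition wiener_integral :: "path measure \<Rightarrow> path \<Rightarrow> (path \<Rightarrow> real) \<Rightarrow> bool" where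
  "wiener_integral \<gamma> h X \<longleftrightarrow>
     X \<in> borel_measurable (completion \<gamma>) \<and>
     integrable (completion \<gamma>) (\<lambda>w. (X w)\<^sup>2) \<and>
     (\<exists>n t c. (\<forall>k. time_grid (n k) (t k)) \<and>
        (\<lambda>k. \<integral>x. (step_function (n k) (t k) (c k) x - deriv h x)\<^sup>2 \<partial>lebesgue_on {0..1})
          \<longlonglongrightarrow> 0 \<and>
        (\<lambda>k. \<integral>w. (step_integral (n k) (t k) (c k) w - X w)\<^sup>2 \<partial>completion \<gamma>) \<longlonglongrightarrow> 0)"

text \<open>
  \<open>I h\<close> is a choice of the version [h] for which the convention
  \<open>[h](w + \<theta>) = [h](w) + \<langle>h,\<theta>\<rangle>\<close> holds simultaneously for all \<open>\<theta>\<close>, for almost every \<open>w\<close>. The set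
  of such \<open>w\<close> is automatically invariant under Cameron-Martin shifts. Such versions exist:
  take the limit, where it exists, of the integrals of the dyadic averages of the derivative
  of \<open>h\<close>, and 0 elsewhere. Asking for the convention at every \<open>w\<close> would rule out Borel
  versions, unless the derivative of \<open>h\<close> has bounded variation.
\<close>

definition wiener_integral_map :: "path measure \<Rightarrow> (path \<Rightarrow> path \<Rightarrow> real) \<Rightarrow> bool" where
  "wiener_integral_map \<gamma> I \<longleftrightarrow>
     (\<forall>h\<in>cameron_martin. wiener_integral \<gamma> h (I h) \<and>
        (AE w in completion \<gamma>. \<forall>\<theta>\<in>cameron_martin. I h (w + \<theta>) = I h w + cm_inner h \<theta>))"


section \<open>Polynomial functionals and the operators acting on them\<close>

text \<open>
  A real polynomial in \<open>n\<close> variables is a finite family of coefficients \<open>a \<alpha>\<close>, indexed by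
  exponent vectors \<open>\<alpha>\<close>, of which only the entries below \<open>n\<close> are used.
\<close>

definition poly_eval ::
  "nat \<Rightarrow> (nat \<Rightarrow> nat) set \<Rightarrow> ((nat \<Rightarrow> nat) \<Rightarrow> real) \<Rightarrow> (nat \<Rightarrow> real) \<Rightarrow> real" where
  "poly_eval n A a x = (\<Sum>\<alpha>\<in>A. a \<alpha> * (\<Prod>i<n. x i ^ \<alpha> i))"

definition polynomial_functionals :: "(path \<Rightarrow> path \<Rightarrow> real) \<Rightarrow> (path \<Rightarrow> real) set" where
  "polynomial_functionals I =
     {F. \<exists>n h A a. (\<forall>i<n. h i \<in> cameron_martin) \<and> finite A \<and>
           (\<forall>w\<in>wiener_space. F w = poly_eval n A a (\<lambda>i. I (h i) w))}"

definition dir_deriv :: "path \<Rightarrow> (path \<Rightarrow> real) \<Rightarrow> path \<Rightarrow> real" where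
  "dir_deriv \<theta> F w = Lim (at 0) (\<lambda>\<epsilon>. (1 / \<epsilon>) * (F (w + \<epsilon> *\<^sub>R \<theta>) - F w))"

definition dir_deriv_adj ::
  "(path \<Rightarrow> path \<Rightarrow> real) \<Rightarrow> path \<Rightarrow> (path \<Rightarrow> real) \<Rightarrow> path \<Rightarrow> real" where
  "dir_deriv_adj I \<theta> F w = - dir_deriv \<theta> F w + I \<theta> w * F w"

definition op_exp_term ::
  "((path \<Rightarrow> real) \<Rightarrow> path \<Rightarrow> real) \<Rightarrow> (path \<Rightarrow> real) \<Rightarrow> path \<Rightarrow> nat \<Rightarrow> real" where
  "op_exp_term T F w n = (1 / fact n) * (T ^^ n) F w"

text \<open>The exponential series of an operator is summed pointwise on the Wiener space.\<close>

definition op_exp ::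
  "((path \<Rightarrow> real) \<Rightarrow> path \<Rightarrow> real) \<Rightarrow> (path \<Rightarrow> real) \<Rightarrow> path \<Rightarrow> real" where
  "op_exp T F w = (\<Sum>n. op_exp_term T F w n)"

end

theory Submission
  imports Defs
begin

text \<open>
  For almost every \<open>w\<close> the shift convention makes \<open>s \<mapsto> F (w + s\<theta>)\<close> a polynomial, so that
  \<open>e\<^sup>D F (w) = F (w + \<theta>)\<close> is Taylor's formula; and \<open>(D\<^sup>*)\<^sup>n 1\<close> is a Hermite polynomial in \<open>[\<theta>] w\<close>,
  whose exponential generating function is the Cameron-Martin density. What remains is
  \<open>E[p ([h] + \<langle>h, \<theta>\<rangle>)] = E[p ([h]) exp ([\<theta>] - \<parallel>\<theta>\<parallel>\<^sup>2 / 2)]\<close>. With \<open>exp ([k])\<close> for arbitrary \<open>k\<close>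
  in place of \<open>p\<close> it follows from the Gaussian formula \<open>E[exp ([k])] = exp (\<parallel>k\<parallel>\<^sup>2 / 2)\<close>, and a factor
  \<open>[h]\<close> is gained by replacing \<open>k\<close> with \<open>k + a h\<close> and differentiating at \<open>a = 0\<close>.
\<close>

section \<open>Square integrable functions and exponentials\<close>

text \<open>No change of variables under the shift is carried out. For almost every \<open>w\<close>
  the convention turns \<open>F (w + \<theta>)\<close> into a polynomial in the variables [h_i](w) +
  <h_i, \<theta>>, so all expectations are taken under the unshifted measure. Exponentials are used
  as test functions because they encode the joint Gaussian law of several Wiener integrals: only the
  law of a single linear combination is ever needed. The first obstacle is that Wiener integrals are
  limits in L2, and this mode of convergence does not carry exponentials along. It does so here
  because the exponential moments of order 2 of the approximations are explicit and therefore
  bounded. The second obstacle is that versions are arbitrary off null sets: linearity of [h] in h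
  and the values of the limits defining D are available only almost everywhere. Measurability is
  therefore recovered from completeness, and derivatives are computed along a whole line through a
  fixed good \<open>w\<close>.\<close>

lemma Cauchy_Schwarz_integral:
  fixes u v :: "'a \<Rightarrow> real"
  assumes [measurable]: "u \<in> borel_measurable M" "v \<in> borel_measurable M"
    and u2: "integrable M (\<lambda>x. (u x)\<^sup>2)" and v2: "integrable M (\<lambda>x. (v x)\<^sup>2)"
  shows "integrable M (\<lambda>x. u x * v x)"
    and "\<bar>\<integral>x. u x * v x \<partial>M\<bar> \<le> sqrt (\<integral>x. (u x)\<^sup>2 \<partial>M) * sqrt (\<integral>x. (v x)\<^sup>2 \<partial>M)"
proof -
  have bound: "\<bar>a * b\<bar> \<le> a\<^sup>2 + b\<^sup>2" for a b :: real
  proof -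
    have "\<bar>a\<bar> * \<bar>b\<bar> \<ge> 0" by simp
    then show ?thesis using sum_squares_bound[of "\<bar>a\<bar>" "\<bar>b\<bar>"] unfolding abs_mult power2_abs by linarith
  qed
  show uv: "integrable M (\<lambda>x. u x * v x)"
    by (rule Bochner_Integration.integrable_bound[of _ "\<lambda>x. (u x)\<^sup>2 + (v x)\<^sup>2"])
      (use u2 v2 bound in auto)
  define A B C where "A = (\<integral>x. (u x)\<^sup>2 \<partial>M)" and "B = (\<integral>x. u x * v x \<partial>M)"
    and "C = (\<integral>x. (v x)\<^sup>2 \<partial>M)"
  \<comment> \<open>Expanding the integral of \<open>(u - t * v)\<^sup>2\<close> gives a quadratic
    in \<open>t\<close>; its minimum, at \<open>B / C\<close>, yields the claim.\<close>
  have nonneg: "A - 2 * t * B + t\<^sup>2 * C \<ge> 0" for t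
  proof -
    have "(\<integral>x. (u x - t * v x)\<^sup>2 \<partial>M) = (\<integral>x. (u x)\<^sup>2 - 2 * t * (u x * v x) + t\<^sup>2 * (v x)\<^sup>2 \<partial>M)"
      by (rule Bochner_Integration.integral_cong) (auto simp: power2_eq_square algebra_simps)
    also have "\<dots> = A - 2 * t * B + t\<^sup>2 * C"
      using u2 v2 uv by (simp add: A_def B_def C_def)
    finally show ?thesis
      by (metis (no_types, lifting) Bochner_Integration.integral_nonneg zero_le_power2)
  qed
  have AC: "A \<ge> 0" "C \<ge> 0" by (auto simp: A_def C_def)
  have "B\<^sup>2 \<le> A * C"
  proof (cases "C = 0")
    case True
    have "B = 0"
    proof (rule ccontr)
      assume "B \<noteq> 0"
      \<comment> \<open>At this \<open>t\<close> the affine function \<open>A - 2 * t * B\<close>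
        takes the value \<open>-1\<close>.\<close>
      with nonneg[of "(A + 1) / (2 * B)"] True show False by simp
    qed
    then show ?thesis using True by simp
  next
    case False
    with AC have "C > 0" by simp
    with nonneg[of "B / C"] show ?thesis
      by (simp add: power2_eq_square field_simps)
  qed
  then have "\<bar>B\<bar> \<le> sqrt (A * C)" by (simp add: real_le_rsqrt)
  then show "\<bar>\<integral>x. u x * v x \<partial>M\<bar> \<le> sqrt (\<integral>x. (u x)\<^sup>2 \<partial>M) * sqrt (\<integral>x. (v x)\<^sup>2 \<partial>M)"
    by (simp add: A_def B_def C_def real_sqrt_mult)
qed

lemma square_integrable_add:
  fixes u v :: "'a \<Rightarrow> real"
  assumes [measurable]: "u \<in> borel_measurable M" "v \<in> borel_measurable M"
    and u2: "integrable M (\<lambda>x. (u x)\<^sup>2)" and v2: "integrable M (\<lambda>x. (v x)\<^sup>2)"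
  shows "integrable M (\<lambda>x. (u x + v x)\<^sup>2)"
  unfolding power2_sum using Cauchy_Schwarz_integral(1)[OF assms] u2 v2
  by (simp add: mult.assoc)

lemma square_integrable_diff:
  fixes u v :: "'a \<Rightarrow> real"
  assumes [measurable]: "u \<in> borel_measurable M" "v \<in> borel_measurable M"
    and u2: "integrable M (\<lambda>x. (u x)\<^sup>2)" and v2: "integrable M (\<lambda>x. (v x)\<^sup>2)"
  shows "integrable M (\<lambda>x. (u x - v x)\<^sup>2)"
  using square_integrable_add[of u M "\<lambda>x. - v x"] assms by simp

text \<open>Square the splitting f = (f - g) + g: by Cauchy-Schwarz the cross term is at most the
  distance times the norm of \<open>g\<close>.\<close>

lemma L2_tendsto_imp_norm_tendsto:
  fixes f :: "nat \<Rightarrow> 'a \<Rightarrow> real"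
  assumes [measurable]: "\<And>k. f k \<in> borel_measurable M" "g \<in> borel_measurable M"
    and f2: "\<And>k. integrable M (\<lambda>x. (f k x)\<^sup>2)" and g2: "integrable M (\<lambda>x. (g x)\<^sup>2)"
    and lim: "(\<lambda>k. \<integral>x. (f k x - g x)\<^sup>2 \<partial>M) \<longlonglongrightarrow> 0"
  shows "(\<lambda>k. \<integral>x. (f k x)\<^sup>2 \<partial>M) \<longlonglongrightarrow> (\<integral>x. (g x)\<^sup>2 \<partial>M)"
proof -
  have d2: "integrable M (\<lambda>x. (f k x - g x)\<^sup>2)" for k
    using f2 g2 by (intro square_integrable_diff) auto
  note CS = Cauchy_Schwarz_integral[OF _ _ d2 g2]
  have eq: "(\<integral>x. (f k x)\<^sup>2 \<partial>M) = (\<integral>x. (f k x - g x)\<^sup>2 \<partial>M)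
      + 2 * (\<integral>x. (f k x - g x) * g x \<partial>M) + (\<integral>x. (g x)\<^sup>2 \<partial>M)" for k
  proof -
    have "(\<integral>x. (f k x)\<^sup>2 \<partial>M)
        = (\<integral>x. (f k x - g x)\<^sup>2 + 2 * ((f k x - g x) * g x) + (g x)\<^sup>2 \<partial>M)"
      by (rule Bochner_Integration.integral_cong) (auto simp: power2_eq_square algebra_simps)
    also have "\<dots> = (\<integral>x. (f k x - g x)\<^sup>2 \<partial>M)
        + 2 * (\<integral>x. (f k x - g x) * g x \<partial>M) + (\<integral>x. (g x)\<^sup>2 \<partial>M)"
      using d2 g2 CS(1) by simp
    finally show ?thesis .
  qed
  have "(\<lambda>k. \<integral>x. (f k x - g x) * g x \<partial>M) \<longlonglongrightarrow> 0"
  proof (rule tendsto_rabs_zero_cancel, rule tendsto_sandwich[OF _ _ tendsto_const])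
    show "(\<lambda>k. sqrt (\<integral>x. (f k x - g x)\<^sup>2 \<partial>M) * sqrt (\<integral>x. (g x)\<^sup>2 \<partial>M)) \<longlonglongrightarrow> 0"
      using tendsto_mult_left_zero[OF tendsto_real_sqrt[OF lim, simplified]] .
  qed (use CS(2) in auto)
  with lim show ?thesis
    unfolding eq by (auto intro!: tendsto_eq_intros)
qed

text \<open>The tangent line inequality for \<open>exp\<close>, made symmetric so that integrands
  can be bounded without knowing which of the two exponents is larger.\<close>

lemma abs_exp_diff_le: "\<bar>exp x - exp y\<bar> \<le> \<bar>x - y\<bar> * (exp x + exp y)" for x y :: real
proof -
  have le: "exp b - exp a \<le> (b - a) * exp b" if "a \<le> b" for a b :: real
    using mult_left_mono[OF exp_ge_add_one_self[of "a - b"], of "exp b"]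
    by (simp add: exp_diff algebra_simps)
  show ?thesis
  proof (cases "x \<le> y")
    case True
    then have "\<bar>exp x - exp y\<bar> = exp y - exp x" by simp
    also have "\<dots> \<le> \<bar>x - y\<bar> * exp y" using le[OF True] True by (simp add: abs_if)
    also have "\<dots> \<le> \<bar>x - y\<bar> * (exp x + exp y)" by (intro mult_left_mono) auto
    finally show ?thesis .
  next
    case False
    then have "\<bar>exp x - exp y\<bar> = exp x - exp y" by simp
    also have "\<dots> \<le> \<bar>x - y\<bar> * exp x" using le[of y x] False by (simp add: abs_if)
    also have "\<dots> \<le> \<bar>x - y\<bar> * (exp x + exp y)" by (intro mult_left_mono) auto
    finally show ?thesis .
  qed
qed

text \<open>Convergence in L2 alone says nothing about exponentials; the bound on the moments of
  order 2 makes up for it. Fatou's lemma passes it on to \<open>Y\<close>, and then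
  \<open>abs_exp_diff_le\<close> with Cauchy-Schwarz bounds the difference of the expectations by
  the L2 distance times a constant.\<close>

lemma (in prob_space) L2_tendsto_imp_exp_tendsto:
  fixes X :: "nat \<Rightarrow> 'a \<Rightarrow> real"
  assumes [measurable]: "\<And>k. X k \<in> borel_measurable M" "Y \<in> borel_measurable M"
    and X2: "\<And>k. integrable M (\<lambda>x. (X k x)\<^sup>2)" and Y2: "integrable M (\<lambda>x. (Y x)\<^sup>2)"
    and lim: "(\<lambda>k. \<integral>x. (X k x - Y x)\<^sup>2 \<partial>M) \<longlonglongrightarrow> 0"
    and exp_int: "\<And>k. integrable M (\<lambda>x. exp (2 * X k x))"
    and exp_bound: "\<And>k. (\<integral>x. exp (2 * X k x) \<partial>M) \<le> C"
  shows "integrable M (\<lambda>x. exp (Y x))"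
    and "(\<lambda>k. \<integral>x. exp (X k x) \<partial>M) \<longlonglongrightarrow> (\<integral>x. exp (Y x) \<partial>M)"
proof -
  have d2: "integrable M (\<lambda>x. (X k x - Y x)\<^sup>2)" for k
    using X2 Y2 by (intro square_integrable_diff) auto
  have d1: "integrable M (\<lambda>x. X k x - Y x)" for k
    by (rule square_integrable_imp_integrable[OF _ d2]) auto
  have "(\<lambda>k. \<integral>x. norm (X k x - Y x) \<partial>M) \<longlonglongrightarrow> 0"
  proof (rule tendsto_sandwich[OF _ _ tendsto_const])
    show "(\<lambda>k. sqrt (\<integral>x. (X k x - Y x)\<^sup>2 \<partial>M)) \<longlonglongrightarrow> 0"
      using tendsto_real_sqrt[OF lim] by simp
    show "\<forall>\<^sub>F k in sequentially. (\<integral>x. norm (X k x - Y x) \<partial>M) \<le> sqrt (\<integral>x. (X k x - Y x)\<^sup>2 \<partial>M)"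
      using Cauchy_Schwarz_integral(2)[of "\<lambda>x. norm (X _ x - Y x)" M "\<lambda>_. 1"] d2
      by (auto simp: prob_space)
  qed auto
  \<comment> \<open>A subsequence is enough, since it only serves to bound the moment of
    \<open>Y\<close>; the limit below is taken along the whole sequence.\<close>
  from tendsto_L1_AE_subseq[OF d1 this] obtain r where r: "strict_mono r"
    and ae: "AE x in M. (\<lambda>k. X (r k) x - Y x) \<longlonglongrightarrow> 0"
    by blast
  have "(\<integral>\<^sup>+x. ennreal (exp (2 * Y x)) \<partial>M)
      = (\<integral>\<^sup>+x. liminf (\<lambda>k. ennreal (exp (2 * X (r k) x))) \<partial>M)"
  proof (rule nn_integral_cong_AE)
    show "AE x in M. ennreal (exp (2 * Y x)) = liminf (\<lambda>k. ennreal (exp (2 * X (r k) x)))"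
      using ae
    proof eventually_elim
      case (elim x)
      then have "(\<lambda>k. X (r k) x) \<longlonglongrightarrow> Y x" by (simp add: LIM_zero_cancel)
      then have "(\<lambda>k. ennreal (exp (2 * X (r k) x))) \<longlonglongrightarrow> ennreal (exp (2 * Y x))"
        by (intro tendsto_ennrealI tendsto_intros)
      then show ?case using lim_imp_Liminf[OF trivial_limit_sequentially] by metis
    qed
  qed
  also have "\<dots> \<le> liminf (\<lambda>k. \<integral>\<^sup>+x. ennreal (exp (2 * X (r k) x)) \<partial>M)"
    by (rule nn_integral_liminf) auto
  also have "\<dots> \<le> ennreal C"
  proof -
    have "(\<integral>\<^sup>+x. ennreal (exp (2 * X (r k) x)) \<partial>M) \<le> ennreal C" for k
      using exp_int exp_bound by (subst nn_integral_eq_integral) (auto intro: ennreal_leI)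
    then show ?thesis
      by (intro Liminf_le) auto
  qed
  finally have "(\<integral>\<^sup>+x. ennreal (exp (2 * Y x)) \<partial>M) < \<infinity>"
    by (simp add: order_le_less_trans)
  then have "integrable M (\<lambda>x. exp (2 * Y x))"
    by (intro integrableI_nonneg) auto
  moreover have sq: "exp (2 * y) = (exp y)\<^sup>2" for y :: real by (simp add: exp_double)
  ultimately have eY2: "integrable M (\<lambda>x. (exp (Y x))\<^sup>2)" by simp
  then show eY: "integrable M (\<lambda>x. exp (Y x))"
    by (rule square_integrable_imp_integrable[rotated]) auto
  have eX2: "integrable M (\<lambda>x. (exp (X k x))\<^sup>2)" for k
    using exp_int[of k] unfolding sq .
  have eX: "integrable M (\<lambda>x. exp (X k x))" for k
    by (rule square_integrable_imp_integrable[OF _ eX2]) auto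
  \<comment> \<open>From \<open>(a + b)\<^sup>2 \<le> 2 * a\<^sup>2 + 2 * b\<^sup>2\<close>, with
    the uniform bound \<open>C\<close> for the first square; it does not depend on
    \<open>k\<close>.\<close>
  define D where "D = 2 * C + 2 * (\<integral>x. (exp (Y x))\<^sup>2 \<partial>M)"
  have le: "\<bar>(\<integral>x. exp (X k x) \<partial>M) - (\<integral>x. exp (Y x) \<partial>M)\<bar>
      \<le> sqrt (\<integral>x. (X k x - Y x)\<^sup>2 \<partial>M) * sqrt D" for k
  proof -
    have s2: "integrable M (\<lambda>x. (exp (X k x) + exp (Y x))\<^sup>2)"
      using eX2 eY2 by (intro square_integrable_add) auto
    note CS = Cauchy_Schwarz_integral[of "\<lambda>x. \<bar>X k x - Y x\<bar>" M, OF _ _ _ s2]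
    have "\<bar>(\<integral>x. exp (X k x) \<partial>M) - (\<integral>x. exp (Y x) \<partial>M)\<bar> = \<bar>\<integral>x. exp (X k x) - exp (Y x) \<partial>M\<bar>"
      using eX eY by simp
    also have "\<dots> \<le> (\<integral>x. \<bar>exp (X k x) - exp (Y x)\<bar> \<partial>M)" by (rule integral_abs_bound)
    also have "\<dots> \<le> (\<integral>x. \<bar>X k x - Y x\<bar> * (exp (X k x) + exp (Y x)) \<partial>M)"
      using eX eY d2 by (intro integral_mono CS(1) abs_exp_diff_le) auto
    also have "\<dots> \<le> sqrt (\<integral>x. (X k x - Y x)\<^sup>2 \<partial>M) * sqrt (\<integral>x. (exp (X k x) + exp (Y x))\<^sup>2 \<partial>M)"
      using CS(2) d2 by fastforce
    also have "(\<integral>x. (exp (X k x) + exp (Y x))\<^sup>2 \<partial>M)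
        \<le> (\<integral>x. 2 * (exp (X k x))\<^sup>2 + 2 * (exp (Y x))\<^sup>2 \<partial>M)"
    proof (intro integral_mono)
      show "(exp (X k x) + exp (Y x))\<^sup>2 \<le> 2 * (exp (X k x))\<^sup>2 + 2 * (exp (Y x))\<^sup>2" for x
        using sum_squares_bound[of "exp (X k x)" "exp (Y x)"] by (simp add: power2_sum)
    qed (use s2 eX2 eY2 in auto)
    also have "\<dots> \<le> D"
      using eX2 eY2 exp_bound[of k] by (simp add: D_def sq)
    finally show ?thesis
      by (simp add: mult_left_mono)
  qed
  have "(\<lambda>k. (\<integral>x. exp (X k x) \<partial>M) - (\<integral>x. exp (Y x) \<partial>M)) \<longlonglongrightarrow> 0"
  proof (rule tendsto_rabs_zero_cancel, rule tendsto_sandwich[OF _ _ tendsto_const])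
    show "(\<lambda>k. sqrt (\<integral>x. (X k x - Y x)\<^sup>2 \<partial>M) * sqrt D) \<longlonglongrightarrow> 0"
      using tendsto_mult_left_zero[OF tendsto_real_sqrt[OF lim, simplified]] .
  qed (use le in auto)
  then show "(\<lambda>k. \<integral>x. exp (X k x) \<partial>M) \<longlonglongrightarrow> (\<integral>x. exp (Y x) \<partial>M)"
    by (simp add: LIM_zero_cancel)
qed

text \<open>Differentiation under the integral at \<open>a = 0\<close>, along the steps 1/(n+1). As
  these are at most 1, the exponentials of \<open>2 * U\<close> and \<open>- 2 * U\<close> dominate
  all difference quotients, which is why integrability is assumed for \<open>a\<close> of both
  signs.\<close>

lemma integral_exp_difference_quotient:
  fixes U g :: "'a \<Rightarrow> real"
  assumes [measurable]: "U \<in> borel_measurable M" "g \<in> borel_measurable M"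
    and int: "\<And>a. integrable M (\<lambda>x. exp (a * U x) * g x)"
  shows "integrable M (\<lambda>x. U x * g x)"
    and "(\<lambda>n. ((\<integral>x. exp (1 / real (Suc n) * U x) * g x \<partial>M) - (\<integral>x. g x \<partial>M)) * real (Suc n))
      \<longlonglongrightarrow> (\<integral>x. U x * g x \<partial>M)"
proof -
  define s where "s n x = (exp (1 / real (Suc n) * U x) * g x - g x) * real (Suc n)" for n x
  define w where "w x = exp (2 * U x) * \<bar>g x\<bar> + exp (- 2 * U x) * \<bar>g x\<bar>" for x
  have [measurable]: "s n \<in> borel_measurable M" for n unfolding s_def by measurable
  have w: "integrable M w"
    unfolding w_def using int[of 2, THEN integrable_abs] int[of "-2", THEN integrable_abs]
    by (simp add: abs_mult)
  have lim: "AE x in M. (\<lambda>n. s n x) \<longlonglongrightarrow> U x * g x"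
  proof (rule AE_I2)
    fix x
    have "((\<lambda>a. exp (a * U x)) has_real_derivative U x) (at 0)"
      by (auto intro!: derivative_eq_intros)
    then have "((\<lambda>a. (exp (a * U x) - 1) / a) \<longlongrightarrow> U x) (at 0)"
      by (simp add: DERIV_def)
    moreover have "filterlim (\<lambda>n. 1 / real (Suc n)) (at 0) sequentially"
      unfolding filterlim_at using LIMSEQ_Suc[OF lim_1_over_n] by simp
    ultimately have "(\<lambda>n. (exp (1 / real (Suc n) * U x) - 1) / (1 / real (Suc n))) \<longlonglongrightarrow> U x"
      by (rule filterlim_compose)
    then have "(\<lambda>n. (exp (1 / real (Suc n) * U x) - 1) / (1 / real (Suc n)) * g x) \<longlonglongrightarrow> U x * g x"
      by (intro tendsto_intros)
    then show "(\<lambda>n. s n x) \<longlonglongrightarrow> U x * g x"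
      by (simp add: s_def algebra_simps)
  qed
  have bound: "AE x in M. norm (s n x) \<le> w x" for n
  proof (rule AE_I2)
    fix x
    define y where "y = 1 / real (Suc n) * U x"
    have y: "\<bar>y\<bar> * real (Suc n) = \<bar>U x\<bar>" and "\<bar>y\<bar> \<le> \<bar>U x\<bar>"
      by (auto simp: y_def abs_mult field_simps mult_left_mono)
    have "\<bar>exp y - 1\<bar> * real (Suc n) \<le> \<bar>y\<bar> * (exp y + 1) * real (Suc n)"
      using abs_exp_diff_le[of y 0] by (intro mult_right_mono) auto
    also have "\<dots> = \<bar>U x\<bar> * (exp y + 1)" using y by (metis mult.assoc mult.commute)
    also have "\<dots> \<le> \<bar>U x\<bar> * (exp \<bar>U x\<bar> + 1)"
      using \<open>\<bar>y\<bar> \<le> \<bar>U x\<bar>\<close> by (intro mult_left_mono) auto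
    also have "\<dots> \<le> exp (2 * \<bar>U x\<bar>)"
    proof -
      define z where "z = \<bar>U x\<bar>"
      \<comment> \<open>Since \<open>z \<le> exp z - 1\<close>, the product below is at most
        \<open>exp (2 * z) - 1\<close>.\<close>
      have "1 + z \<le> exp z" by (rule exp_ge_add_one_self)
      then have "z * (exp z + 1) \<le> (exp z - 1) * (exp z + 1)"
        by (intro mult_right_mono) (auto simp: le_diff_eq add.commute)
      also have "\<dots> \<le> exp (2 * z)"
        by (simp add: mult_exp_exp algebra_simps)
      finally show ?thesis by (simp add: z_def)
    qed
    also have "\<dots> \<le> exp (2 * U x) + exp (- 2 * U x)"
      by (auto simp: abs_if)
    finally have "\<bar>exp y - 1\<bar> * real (Suc n) * \<bar>g x\<bar> \<le> w x"
      by (auto simp: w_def distrib_right[symmetric] intro: mult_right_mono)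
    moreover have "norm (s n x) = \<bar>exp y - 1\<bar> * real (Suc n) * \<bar>g x\<bar>"
    proof -
      have "s n x = (exp y - 1) * real (Suc n) * g x"
        by (simp add: s_def y_def algebra_simps)
      then show ?thesis by (simp add: abs_mult)
    qed
    ultimately show "norm (s n x) \<le> w x" by simp
  qed
  show "integrable M (\<lambda>x. U x * g x)"
    by (rule integrable_dominated_convergence[OF _ _ w lim bound]) auto
  have "(\<lambda>n. \<integral>x. s n x \<partial>M) \<longlonglongrightarrow> (\<integral>x. U x * g x \<partial>M)"
    by (rule integral_dominated_convergence[OF _ _ w lim bound]) auto
  then show "(\<lambda>n. ((\<integral>x. exp (1 / real (Suc n) * U x) * g x \<partial>M) - (\<integral>x. g x \<partial>M)) * real (Suc n))
      \<longlonglongrightarrow> (\<integral>x. U x * g x \<partial>M)"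
    unfolding s_def using int[of "1 / real (Suc _)"] int[of 0] by simp
qed

section \<open>Almost everywhere equality in complete measures\<close>

lemma (in complete_measure) borel_measurable_cong_AE_complete:
  assumes "f \<in> borel_measurable M" "AE x in M. f x = g x"
  shows "g \<in> borel_measurable M"
proof (rule measurableI)
  fix A :: "'b set" assume "A \<in> sets borel"
  then have "f -` A \<inter> space M \<in> sets M"
    using assms(1) by (rule measurable_sets[rotated])
  moreover have "AE x in M. (x \<in> f -` A \<inter> space M) = (x \<in> g -` A \<inter> space M)"
    using assms(2) by eventually_elim auto
  ultimately show "g -` A \<inter> space M \<in> sets M"
    using in_sets_AE by blast
qed auto

text \<open>Measurability of \<open>f\<close> is a consequence here. The integrands with
  \<open>F (w + \<theta>)\<close> and \<open>op_exp\<close> need this: they are identified only off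
  a null set, on which the limits and sums defining them may be anything.\<close>

lemma (in complete_measure) integral_cong_AE_complete:
  fixes f g :: "'a \<Rightarrow> real"
  assumes "integrable M g" "AE x in M. f x = g x"
  shows "integrable M f" and "(\<integral>x. f x \<partial>M) = (\<integral>x. g x \<partial>M)"
proof -
  have g: "g \<in> borel_measurable M" using assms(1) by simp
  have "AE x in M. g x = f x" using assms(2) by eventually_elim simp
  with g have f: "f \<in> borel_measurable M" by (rule borel_measurable_cong_AE_complete)
  show "integrable M f" using integrable_cong_AE[OF f g assms(2)] assms(1) by simp
  show "(\<integral>x. f x \<partial>M) = (\<integral>x. g x \<partial>M)" by (rule integral_cong_AE[OF f g assms(2)])
qed

text \<open>Serves the derivative of a scaled path, which is identified only at points of
  differentiability; completeness makes it measurable all the same.\<close>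

lemma complete_measure_lebesgue_on:
  assumes "S \<in> sets lebesgue"
  shows "complete_measure (lebesgue_on S)"
proof
  fix A B :: "'a set" assume "B \<subseteq> A" "A \<in> null_sets (lebesgue_on S)"
  then have "A \<in> null_sets lebesgue" "B \<subseteq> S"
    using assms null_sets_restrict_space[of S lebesgue A] by auto
  with \<open>B \<subseteq> A\<close> have "B \<in> sets lebesgue"
    by (blast intro: completion.complete)
  then show "B \<in> sets (lebesgue_on S)"
    using assms \<open>B \<subseteq> S\<close> by (simp add: sets_restrict_space_iff)
qed

section \<open>Gaussian exponential moments\<close>

lemma normal_density_exp:
  assumes "\<sigma> > 0"
  shows "normal_density 0 \<sigma> x * exp (a * x)
    = exp (a\<^sup>2 * \<sigma>\<^sup>2 / 2) * normal_density (a * \<sigma>\<^sup>2) \<sigma> x"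
proof -
  \<comment> \<open>Completing the square: the exponential tilt moves the mean from 0 to
    \<open>a * \<sigma>\<^sup>2\<close> and leaves a constant factor.\<close>
  have "- x\<^sup>2 / (2 * \<sigma>\<^sup>2) + a * x = a\<^sup>2 * \<sigma>\<^sup>2 / 2 + - (x - a * \<sigma>\<^sup>2)\<^sup>2 / (2 * \<sigma>\<^sup>2)"
    using assms by (simp add: power2_eq_square field_simps)
  then show ?thesis
    by (simp add: normal_density_def flip: exp_add)
qed

lemma (in prob_space) normal_mgf:
  assumes "distributed M lborel X (normal_density 0 \<sigma>)" "\<sigma> > 0"
  shows "integrable M (\<lambda>w. exp (a * X w))"
    and "(\<integral>w. exp (a * X w) \<partial>M) = exp (a\<^sup>2 * \<sigma>\<^sup>2 / 2)"
proof -
  have "integrable M (\<lambda>w. exp (a * X w))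
      \<longleftrightarrow> integrable lborel (\<lambda>x. normal_density 0 \<sigma> x * exp (a * x))"
    using distributed_integrable[OF assms(1), of "\<lambda>x. exp (a * x)"] by simp
  then show "integrable M (\<lambda>w. exp (a * X w))"
    using assms(2) by (simp add: normal_density_exp)
  have "(\<integral>w. exp (a * X w) \<partial>M) = (\<integral>x. normal_density 0 \<sigma> x * exp (a * x) \<partial>lborel)"
    using distributed_integral[OF assms(1), of "\<lambda>x. exp (a * x)"] by simp
  then show "(\<integral>w. exp (a * X w) \<partial>M) = exp (a\<^sup>2 * \<sigma>\<^sup>2 / 2)"
    using assms(2) by (simp add: normal_density_exp)
qed

section \<open>Finite combinations of Brownian values\<close>

text \<open>A list of pairs \<open>(c, t)\<close> encodes the step function \<open>\<Sum> c 1\<^bsub>(0,t]\<^esub>\<close> and its Wiener integral \<open>\<Sum> c w(t)\<close>.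
  Unlike the representation over time grids it is closed under sums without refining grids.\<close>

definition ramp_fun :: "(real \<times> real) list \<Rightarrow> real \<Rightarrow> real" where
  "ramp_fun ps x = (\<Sum>(c, t)\<leftarrow>ps. c * indicator {0<..t} x)"

definition ramp_var :: "(real \<times> real) list \<Rightarrow> path \<Rightarrow> real" where
  "ramp_var ps w = (\<Sum>(c, t)\<leftarrow>ps. c * w t)"

lemma ramp_append:
  "ramp_fun (ps @ qs) x = ramp_fun ps x + ramp_fun qs x"
  "ramp_var (ps @ qs) w = ramp_var ps w + ramp_var qs w"
  by (simp_all add: ramp_fun_def ramp_var_def)

lemma ramp_concat:
  "ramp_fun (concat (map f [0..<n])) x = (\<Sum>i<n. ramp_fun (f i) x)"
  "ramp_var (concat (map f [0..<n])) w = (\<Sum>i<n. ramp_var (f i) w)"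
  by (induction n) (simp_all add: ramp_append, simp_all add: ramp_fun_def ramp_var_def)

lemma ramp_scale:
  "ramp_fun (map (\<lambda>(c, t). (a * c, t)) ps) x = a * ramp_fun ps x"
  "ramp_var (map (\<lambda>(c, t). (a * c, t)) ps) w = a * ramp_var ps w"
  by (induction ps) (auto simp: ramp_fun_def ramp_var_def algebra_simps)

lemma ramp_fun_measurable [measurable]: "ramp_fun ps \<in> borel_measurable (lebesgue_on {0..1})"
proof -
  have "ramp_fun ps \<in> borel_measurable borel"
    unfolding ramp_fun_def by (induction ps) (auto simp: case_prod_beta)
  then have "ramp_fun ps \<in> borel_measurable lebesgue"
    by (simp add: measurable_completion)
  then show ?thesis by (rule measurable_restrict_space1)
qed

lemma time_grid_mono:
  assumes "time_grid n t" "i \<le> j" "j \<le> n"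
  shows "t i \<le> t j"
  using assms(2,3)
proof (induction j rule: dec_induct)
  case (step k)
  with assms(1) show ?case unfolding time_grid_def
    by (meson Suc_le_lessD less_imp_le order_trans)
qed simp

lemma time_grid_bounds:
  assumes "time_grid n t" "i \<le> n"
  shows "0 \<le> t i" "t i \<le> 1"
  using time_grid_mono[OF assms(1), of 0 i] time_grid_mono[OF assms(1), of i n] assms
  by (auto simp: time_grid_def)

text \<open>A cell \<open>{t i<..t (Suc i)}\<close> is the difference of two intervals that begin at
  0, so it contributes one pair with coefficient \<open>c i\<close> and one with
  \<open>- c i\<close>.\<close>

lemma step_eq_ramp:
  assumes "time_grid n t"
  obtains ps where "snd ` set ps \<subseteq> {0..1}"
    and "step_function n t c = ramp_fun ps" and "step_integral n t c = ramp_var ps"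
proof
  define ps where "ps = concat (map (\<lambda>i. [(c i, t (Suc i)), (- c i, t i)]) [0..<n])"
  show "snd ` set ps \<subseteq> {0..1}"
    using time_grid_bounds[OF assms] by (auto simp: ps_def)
  have "ramp_fun ps x = step_function n t c x" for x
  proof -
    have ind: "indicator {a<..b} x = (indicator {0<..b} x - indicator {0<..a} x :: real)"
      if "0 \<le> a" "a \<le> b" for a b
      using that by (auto simp: indicator_def)
    have "ramp_fun ps x = (\<Sum>i<n. c i * (indicator {0<..t (Suc i)} x - indicator {0<..t i} x))"
      by (simp add: ps_def ramp_concat(1)) (simp add: ramp_fun_def algebra_simps)
    also have "\<dots> = step_function n t c x"
      unfolding step_function_def
      using time_grid_bounds[OF assms] time_grid_mono[OF assms]
      by (intro sum.cong refl) (simp add: ind[of "t _" "t (Suc _)"])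
    finally show ?thesis .
  qed
  then show "step_function n t c = ramp_fun ps" by auto
  have "ramp_var ps w = step_integral n t c w" for w
  proof -
    show ?thesis
      by (simp add: ps_def ramp_concat(2)) (simp add: ramp_var_def step_integral_def algebra_simps)
  qed
  then show "step_integral n t c = ramp_var ps" by auto
qed

text \<open>Independence and the Gaussian law are given for increments over a grid, so a list has to
  be brought back to one. The agreement of the variables uses \<open>w 0 = 0\<close>.\<close>

lemma ramp_eq_step:
  assumes "snd ` set ps \<subseteq> {0..1}"
  obtains n t c where "time_grid n t" and "ramp_fun ps = step_function n t c"
    and "\<And>w. w \<in> wiener_space \<Longrightarrow> ramp_var ps w = step_integral n t c w"
proof -
  \<comment> \<open>The ramps start at 0, hence this point is added; it also provides a grid when
    the list is empty.\<close>
  define L where "L = sorted_list_of_set (insert 0 (snd ` set ps))"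
  have set_L: "set L = insert 0 (snd ` set ps)" and sorted: "sorted_wrt (<) L"
    unfolding L_def using set_sorted_list_of_set[of "insert 0 (snd ` set ps)"]
      strict_sorted_list_of_set[of "insert 0 (snd ` set ps)"] by (auto simp del: sorted_list_of_set_insert)
  define n where "n = length L - 1"
  have len: "length L = Suc n"
    using set_L by (cases L) (auto simp: n_def)
  define t where "t i = L ! i" for i
  have t_less: "t i < t j \<longleftrightarrow> i < j" if "i \<le> n" "j \<le> n" for i j
    using sorted_wrt_nth_less[OF sorted, of i j] sorted_wrt_nth_less[OF sorted, of j i] that len
    by (cases i j rule: linorder_cases) (auto simp: t_def)
  have t_range: "0 \<le> t i" "t i \<le> 1" if "i \<le> n" for i
    using assms set_L nth_mem[of i L] that len by (auto simp: t_def)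
  have t_0: "t 0 = 0"
  proof -
    obtain i where "i \<le> n" "t i = 0"
      using set_L len by (metis in_set_conv_nth insertI1 less_Suc_eq_le t_def)
    then show ?thesis using t_less[of 0 i] t_range[of 0] by (cases "i = 0") auto
  qed
  have grid: "time_grid n t"
    using t_less t_range by (auto simp: time_grid_def)
  \<comment> \<open>The value of \<open>ramp_fun ps\<close> on the cell
    \<open>{t i<..t (Suc i)}\<close>: all ends are grid points, so a ramp that ends beyond
    \<open>t i\<close> covers the whole cell.\<close>
  define c where "c i = (\<Sum>(a, s)\<leftarrow>ps. if t i < s then a else 0)" for i
  have telescope: "(\<Sum>i<n. if t i < s then g (t (Suc i)) - g (t i) else 0) = g s - g 0"
    if s: "s \<in> snd ` set ps" for s and g :: "real \<Rightarrow> real"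
  proof -
    obtain j where j: "j \<le> n" "s = t j"
      using set_L len s by (metis in_set_conv_nth insertI2 less_Suc_eq_le t_def)
    have "(\<Sum>i<n. if t i < s then g (t (Suc i)) - g (t i) else 0)
        = (\<Sum>i<j. g (t (Suc i)) - g (t i))"
      using j t_less by (intro sum.mono_neutral_cong_right) auto
    also have "\<dots> = g s - g 0"
      using sum_lessThan_telescope[of "\<lambda>i. g (t i)" j] t_0 j by simp
    finally show ?thesis .
  qed
  \<comment> \<open>Summation by parts for an arbitrary \<open>g\<close>: the indicator of
    \<open>{0<..s}\<close> at a fixed point, as a function of \<open>s\<close>, yields the
    functions, and \<open>g = w\<close> yields the variables.\<close>
  have regroup: "(\<Sum>i<n. c i * (g (t (Suc i)) - g (t i))) = (\<Sum>(a, s)\<leftarrow>ps. a * (g s - g 0))"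
    for g :: "real \<Rightarrow> real"
  proof -
    \<comment> \<open>Induction over the sublist \<open>qs\<close> keeps the grid fixed, which is
      built from all of \<open>ps\<close>.\<close>
    have "(\<Sum>i<n. (\<Sum>(a, s)\<leftarrow>qs. if t i < s then a else 0) * (g (t (Suc i)) - g (t i)))
        = (\<Sum>(a, s)\<leftarrow>qs. a * (g s - g 0))" if "set qs \<subseteq> set ps" for qs
      using that
    proof (induction qs)
      case (Cons p qs)
      obtain a s where p: "p = (a, s)" by (cases p)
      have s: "s \<in> snd ` set ps" using Cons.prems p by force
      have "(\<Sum>i<n. (if t i < s then a else 0) * (g (t (Suc i)) - g (t i)))
          = a * (\<Sum>i<n. if t i < s then g (t (Suc i)) - g (t i) else 0)"
        unfolding sum_distrib_left by (intro sum.cong) auto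
      also have "\<dots> = a * (g s - g 0)" using telescope[OF s] by simp
      finally show ?case using Cons p by (simp add: distrib_right sum.distrib)
    qed simp
    then show ?thesis by (simp add: c_def)
  qed
  show thesis
  proof (rule that[OF grid])
    show "ramp_fun ps = step_function n t c"
    proof
      fix x
      have "indicator {t i<..t (Suc i)} x
          = (indicator {0<..t (Suc i)} x - indicator {0<..t i} x :: real)" if "i < n" for i
        using that t_range[of i] t_less[of i "Suc i"] by (auto simp: indicator_def)
      then show "ramp_fun ps x = step_function n t c x"
        using regroup[of "\<lambda>s. indicator {0<..s} x"]
        by (simp add: ramp_fun_def step_function_def)
    qed
    show "ramp_var ps w = step_integral n t c w" if "w \<in> wiener_space" for w
      using regroup[of w] that
      by (simp add: ramp_var_def step_integral_def wiener_space_def)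
  qed
qed

lemma step_function_norm:
  assumes "time_grid n t"
  shows "integrable (lebesgue_on {0..1}) (\<lambda>x. (step_function n t c x)\<^sup>2)"
    and "(\<integral>x. (step_function n t c x)\<^sup>2 \<partial>lebesgue_on {0..1}) = (\<Sum>i<n. (c i)\<^sup>2 * (t (Suc i) - t i))"
proof -
  \<comment> \<open>The cells are disjoint, so at most one summand is nonzero and the square moves
    inside the sum.\<close>
  have sq: "(step_function n t c x)\<^sup>2 = (\<Sum>i<n. (c i)\<^sup>2 * indicator {t i<..t (Suc i)} x)" for x
  proof (cases "\<exists>i<n. x \<in> {t i<..t (Suc i)}")
    case True
    then obtain i where i: "i < n" "x \<in> {t i<..t (Suc i)}" by auto
    have "x \<notin> {t j<..t (Suc j)}" if "j < n" "j \<noteq> i" for j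
      using i that time_grid_mono[OF assms, of "Suc i" j] time_grid_mono[OF assms, of "Suc j" i]
      by (cases i j rule: linorder_cases) auto
    then have "(\<Sum>j<n. a j * indicator {t j<..t (Suc j)} x) = a i" for a :: "nat \<Rightarrow> real"
      using i by (subst sum.remove[of _ i]) auto
    then show ?thesis by (simp add: step_function_def)
  next
    case False
    then show ?thesis by (simp add: step_function_def)
  qed
  have sub: "{t i<..t (Suc i)} \<subseteq> {0..1}" if "i < n" for i
    using that time_grid_bounds[OF assms, of i] time_grid_bounds[OF assms, of "Suc i"] by auto
  have meas: "measure (lebesgue_on {0..1}) {t i<..t (Suc i)} = t (Suc i) - t i"
      "{t i<..t (Suc i)} \<in> sets (lebesgue_on {0..1})"
      "emeasure (lebesgue_on {0..1}) {t i<..t (Suc i)} < \<infinity>" if "i < n" for i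
    using sub[OF that] time_grid_mono[OF assms, of i "Suc i"] that
    by (auto simp: measure_restrict_space emeasure_restrict_space sets_restrict_space_iff)
  have int: "integrable (lebesgue_on {0..1}) (\<lambda>x. (c i)\<^sup>2 * indicator {t i<..t (Suc i)} x)"
    if "i < n" for i
    using meas[OF that] by (intro integrable_mult_right integrable_real_indicator) auto
  then show "integrable (lebesgue_on {0..1}) (\<lambda>x. (step_function n t c x)\<^sup>2)"
    unfolding sq by (intro Bochner_Integration.integrable_sum) auto
  show "(\<integral>x. (step_function n t c x)\<^sup>2 \<partial>lebesgue_on {0..1}) = (\<Sum>i<n. (c i)\<^sup>2 * (t (Suc i) - t i))"
    unfolding sq using meas int
    by (subst Bochner_Integration.integral_sum) (auto intro!: sum.cong simp: Int_absorb2 sub)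
qed

section \<open>Exponential moments of step integrals\<close>

lemma wiener_measureD:
  assumes "wiener_measure \<gamma>"
  shows "prob_space \<gamma>" and "space \<gamma> = wiener_space"
proof -
  show "prob_space \<gamma>" using assms by (simp add: wiener_measure_def)
  have "space \<gamma> = space (restrict_space borel wiener_space)"
    using assms sets_eq_imp_space_eq unfolding wiener_measure_def by blast
  then show "space \<gamma> = wiener_space" by (simp add: space_restrict_space)
qed

text \<open>Independence factorizes the expectation, and the variances
  \<open>(c i)\<^sup>2 * (t (Suc i) - t i)\<close> add up to the squared norm of the step
  function.\<close>

lemma step_integral_mgf:
  assumes wm: "wiener_measure \<gamma>" and grid: "time_grid n t"
  shows "integrable \<gamma> (\<lambda>w. exp (step_integral n t c w))"
    and "(\<integral>w. exp (step_integral n t c w) \<partial>\<gamma>)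
      = exp ((\<integral>x. (step_function n t c x)\<^sup>2 \<partial>lebesgue_on {0..1}) / 2)"
    and "step_integral n t c \<in> borel_measurable \<gamma>"
proof -
  interpret prob_space \<gamma> using wiener_measureD[OF wm] by simp
  define D where "D i w = w (t (Suc i)) - w (t i)" for i and w :: path
  have t: "t i < t (Suc i)" "0 \<le> t i" "t (Suc i) \<le> 1" if "i < n" for i
    using that grid time_grid_bounds[OF grid, of i] time_grid_bounds[OF grid, of "Suc i"]
    by (auto simp: time_grid_def)
  have dist: "distributed \<gamma> lborel (D i) (normal_density 0 (sqrt (t (Suc i) - t i)))" if "i < n" for i
    using wm t[OF that] unfolding wiener_measure_def D_def by blast
  have mgf: "integrable \<gamma> (\<lambda>w. exp (c i * D i w))"
    "(\<integral>w. exp (c i * D i w) \<partial>\<gamma>) = exp ((c i)\<^sup>2 * (t (Suc i) - t i) / 2)" if "i < n" for i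
    using normal_mgf[OF dist[OF that], of "c i"] t[OF that] by auto
  have indep: "indep_vars (\<lambda>_. borel) D {..<n}"
    using wm grid unfolding wiener_measure_def D_def by blast
  have indep': "indep_vars (\<lambda>_. borel) (\<lambda>i w. exp (c i * D i w)) {..<n}"
    by (rule indep_vars_compose2[OF indep]) measurable
  have eq: "exp (step_integral n t c w) = (\<Prod>i<n. exp (c i * D i w))" for w
    by (simp add: step_integral_def D_def exp_sum)
  show "integrable \<gamma> (\<lambda>w. exp (step_integral n t c w))"
    unfolding eq using indep' mgf by (intro indep_vars_integrable) auto
  have "(\<integral>w. exp (step_integral n t c w) \<partial>\<gamma>) = (\<Prod>i<n. exp ((c i)\<^sup>2 * (t (Suc i) - t i) / 2))"
    unfolding eq using indep' mgf by (subst indep_vars_lebesgue_integral) auto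
  then show "(\<integral>w. exp (step_integral n t c w) \<partial>\<gamma>)
      = exp ((\<integral>x. (step_function n t c x)\<^sup>2 \<partial>lebesgue_on {0..1}) / 2)"
    by (simp add: step_function_norm[OF grid] exp_sum sum_divide_distrib)
  show "step_integral n t c \<in> borel_measurable \<gamma>"
  proof -
    have "D i \<in> borel_measurable \<gamma>" if "i < n" for i
      using distributed_measurable[OF dist[OF that]] by simp
    then have "(\<lambda>w. \<Sum>i<n. c i * D i w) \<in> borel_measurable \<gamma>"
      by (intro borel_measurable_sum borel_measurable_times) auto
    then show ?thesis by (simp add: step_integral_def[abs_def] D_def)
  qed
qed

text \<open>The parameter \<open>a\<close> is needed at 1 for the Gaussian formula, at 2 for the
  uniform bound that carries this formula to limits, and at 1 and -1 together for the second
  moment.\<close>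

lemma ramp_mgf:
  assumes wm: "wiener_measure \<gamma>" and ps: "snd ` set ps \<subseteq> {0..1}"
  shows "ramp_var ps \<in> borel_measurable (completion \<gamma>)"
    and "integrable (completion \<gamma>) (\<lambda>w. exp (a * ramp_var ps w))"
    and "(\<integral>w. exp (a * ramp_var ps w) \<partial>completion \<gamma>)
      = exp (a\<^sup>2 * (\<integral>x. (ramp_fun ps x)\<^sup>2 \<partial>lebesgue_on {0..1}) / 2)"
    and "integrable (completion \<gamma>) (\<lambda>w. (ramp_var ps w)\<^sup>2)"
    and "integrable (lebesgue_on {0..1}) (\<lambda>x. (ramp_fun ps x)\<^sup>2)"
proof -
  obtain n t c where grid: "time_grid n t" and fn: "ramp_fun ps = step_function n t c"
    and var: "\<And>w. w \<in> wiener_space \<Longrightarrow> ramp_var ps w = step_integral n t c w"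
    using ramp_eq_step[OF ps] by blast
  note sp = wiener_measureD(2)[OF wm]
  have "ramp_var ps \<in> borel_measurable \<gamma> \<longleftrightarrow> step_integral n t c \<in> borel_measurable \<gamma>"
    by (rule measurable_cong) (simp add: sp var)
  then have meas_\<gamma>: "ramp_var ps \<in> borel_measurable \<gamma>"
    using step_integral_mgf(3)[OF wm grid] by simp
  then show meas [measurable]: "ramp_var ps \<in> borel_measurable (completion \<gamma>)"
    by (rule measurable_completion)
  show "integrable (lebesgue_on {0..1}) (\<lambda>x. (ramp_fun ps x)\<^sup>2)"
    unfolding fn by (rule step_function_norm[OF grid])
  have scale: "a * step_integral n t c w = step_integral n t (\<lambda>i. a * c i) w"
      "a * step_function n t c x = step_function n t (\<lambda>i. a * c i) x" for a w x
    by (simp_all add: step_integral_def step_function_def sum_distrib_left mult.assoc del: sum_mult_indicator)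
  have int: "integrable \<gamma> (\<lambda>w. exp (a * ramp_var ps w))" for a
  proof -
    have "integrable \<gamma> (\<lambda>w. exp (a * ramp_var ps w))
        \<longleftrightarrow> integrable \<gamma> (\<lambda>w. exp (step_integral n t (\<lambda>i. a * c i) w))"
      by (rule Bochner_Integration.integrable_cong) (auto simp: sp var scale)
    then show ?thesis using step_integral_mgf(1)[OF wm grid] by simp
  qed
  have int': "integrable (completion \<gamma>) (\<lambda>w. exp (a * ramp_var ps w))" for a
    using meas_\<gamma> int by (subst integrable_completion) auto
  then show "integrable (completion \<gamma>) (\<lambda>w. exp (a * ramp_var ps w))" .
  have "(\<integral>w. exp (a * ramp_var ps w) \<partial>completion \<gamma>) = (\<integral>w. exp (a * ramp_var ps w) \<partial>\<gamma>)"
    using meas_\<gamma> by (intro integral_completion) auto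
  also have "\<dots> = (\<integral>w. exp (step_integral n t (\<lambda>i. a * c i) w) \<partial>\<gamma>)"
    by (rule Bochner_Integration.integral_cong) (auto simp: sp var scale)
  also have "\<dots> = exp ((\<integral>x. (a * step_function n t c x)\<^sup>2 \<partial>lebesgue_on {0..1}) / 2)"
    using step_integral_mgf(2)[OF wm grid] by (simp add: scale)
  finally show "(\<integral>w. exp (a * ramp_var ps w) \<partial>completion \<gamma>)
      = exp (a\<^sup>2 * (\<integral>x. (ramp_fun ps x)\<^sup>2 \<partial>lebesgue_on {0..1}) / 2)"
    by (simp add: fn power_mult_distrib)
  \<comment> \<open>Second moments are dominated by exponential ones; the factors \<open>1\<close>
    and \<open>- 1\<close> are written out to match \<open>int'\<close>.\<close>
  have bound: "y\<^sup>2 \<le> 2 * (exp (1 * y) + exp (- 1 * y))" for y :: real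
  proof -
    have "(\<bar>y\<bar>)\<^sup>2 \<le> 2 * exp \<bar>y\<bar>" using exp_lower_Taylor_quadratic[of "\<bar>y\<bar>"] by simp
    also have "exp \<bar>y\<bar> \<le> exp y + exp (- y)" by (simp add: abs_if)
    finally show ?thesis by simp
  qed
  show "integrable (completion \<gamma>) (\<lambda>w. (ramp_var ps w)\<^sup>2)"
  proof (rule Bochner_Integration.integrable_bound)
    show "integrable (completion \<gamma>)
        (\<lambda>w. 2 * (exp (1 * ramp_var ps w) + exp (- 1 * ramp_var ps w)))"
      by (intro integrable_mult_right Bochner_Integration.integrable_add int')
  qed (use bound in \<open>auto intro!: AE_I2 simp: abs_of_nonneg add_nonneg_nonneg\<close>)
qed

section \<open>Gaussian pairs\<close>

text \<open>\<open>X\<close> is a Wiener integral of \<open>f\<close>. Unlike \<^const>\<open>wiener_integral\<close>, the integrand need not be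
  given as the derivative of a path, so linear combinations are immediate.\<close>

definition wiener_pair :: "path measure \<Rightarrow> (real \<Rightarrow> real) \<Rightarrow> (path \<Rightarrow> real) \<Rightarrow> bool" where
  "wiener_pair \<gamma> f X \<longleftrightarrow>
     f \<in> borel_measurable (lebesgue_on {0..1}) \<and> integrable (lebesgue_on {0..1}) (\<lambda>x. (f x)\<^sup>2) \<and>
     X \<in> borel_measurable (completion \<gamma>) \<and> integrable (completion \<gamma>) (\<lambda>w. (X w)\<^sup>2) \<and>
     (\<exists>ps. (\<forall>k. snd ` set (ps k) \<subseteq> {0..1}) \<and>
        (\<lambda>k. \<integral>x. (ramp_fun (ps k) x - f x)\<^sup>2 \<partial>lebesgue_on {0..1}) \<longlonglongrightarrow> 0 \<and>
        (\<lambda>k. \<integral>w. (ramp_var (ps k) w - X w)\<^sup>2 \<partial>completion \<gamma>) \<longlonglongrightarrow> 0)"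

lemma wiener_pairD:
  assumes "wiener_pair \<gamma> f X"
  shows "f \<in> borel_measurable (lebesgue_on {0..1})"
    and "integrable (lebesgue_on {0..1}) (\<lambda>x. (f x)\<^sup>2)"
    and "X \<in> borel_measurable (completion \<gamma>)"
    and "integrable (completion \<gamma>) (\<lambda>w. (X w)\<^sup>2)"
  using assms unfolding wiener_pair_def by blast+

lemma wiener_pair_zero: "wiener_pair \<gamma> (\<lambda>_. 0) (\<lambda>_. 0)"
  unfolding wiener_pair_def
  by (auto intro!: exI[of _ "\<lambda>_. []"] simp: ramp_fun_def ramp_var_def)

lemma wiener_pair_deriv:
  assumes "h \<in> cameron_martin" "wiener_integral \<gamma> h X"
  shows "wiener_pair \<gamma> (deriv h) X"
proof -
  obtain n t c where grid: "\<And>k. time_grid (n k) (t k)"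
    and lim: "(\<lambda>k. \<integral>x. (step_function (n k) (t k) (c k) x - deriv h x)\<^sup>2 \<partial>lebesgue_on {0..1}) \<longlonglongrightarrow> 0"
      "(\<lambda>k. \<integral>w. (step_integral (n k) (t k) (c k) w - X w)\<^sup>2 \<partial>completion \<gamma>) \<longlonglongrightarrow> 0"
    using assms(2) unfolding wiener_integral_def by blast
  have "\<forall>k. \<exists>ps. snd ` set ps \<subseteq> {0..1} \<and> step_function (n k) (t k) (c k) = ramp_fun ps \<and>
      step_integral (n k) (t k) (c k) = ramp_var ps"
    using step_eq_ramp[OF grid] by metis
  then obtain ps where "\<And>k. snd ` set (ps k) \<subseteq> {0..1}"
    "\<And>k. step_function (n k) (t k) (c k) = ramp_fun (ps k)"
    "\<And>k. step_integral (n k) (t k) (c k) = ramp_var (ps k)"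
    by metis
  with lim assms show ?thesis
    unfolding wiener_pair_def cameron_martin_def wiener_integral_def by auto
qed

lemma L2_tendsto_add:
  fixes f g :: "nat \<Rightarrow> 'a \<Rightarrow> real"
  assumes [measurable]: "\<And>k. f k \<in> borel_measurable M" "u \<in> borel_measurable M"
      "\<And>k. g k \<in> borel_measurable M" "v \<in> borel_measurable M"
    and int: "\<And>k. integrable M (\<lambda>x. (f k x)\<^sup>2)" "integrable M (\<lambda>x. (u x)\<^sup>2)"
      "\<And>k. integrable M (\<lambda>x. (g k x)\<^sup>2)" "integrable M (\<lambda>x. (v x)\<^sup>2)"
    and lim: "(\<lambda>k. \<integral>x. (f k x - u x)\<^sup>2 \<partial>M) \<longlonglongrightarrow> 0" "(\<lambda>k. \<integral>x. (g k x - v x)\<^sup>2 \<partial>M) \<longlonglongrightarrow> 0"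
  shows "(\<lambda>k. \<integral>x. ((f k x + g k x) - (u x + v x))\<^sup>2 \<partial>M) \<longlonglongrightarrow> 0"
proof (rule tendsto_sandwich[OF _ _ tendsto_const])
  show "(\<lambda>k. 2 * (\<integral>x. (f k x - u x)\<^sup>2 \<partial>M) + 2 * (\<integral>x. (g k x - v x)\<^sup>2 \<partial>M)) \<longlonglongrightarrow> 0"
    using lim by (auto intro!: tendsto_eq_intros)
  have le: "((f k x + g k x) - (u x + v x))\<^sup>2 \<le> 2 * (f k x - u x)\<^sup>2 + 2 * (g k x - v x)\<^sup>2" for k x
    using sum_squares_bound[of "f k x - u x" "g k x - v x"] power2_sum[of "f k x - u x" "g k x - v x"]
    by (simp add: algebra_simps)
  have "(\<integral>x. ((f k x + g k x) - (u x + v x))\<^sup>2 \<partial>M)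
      \<le> (\<integral>x. 2 * (f k x - u x)\<^sup>2 + 2 * (g k x - v x)\<^sup>2 \<partial>M)" for k
    using int by (intro integral_mono[OF _ _ le] Bochner_Integration.integrable_add
        integrable_mult_right square_integrable_diff square_integrable_add) auto
  also have "(\<integral>x. 2 * (f k x - u x)\<^sup>2 + 2 * (g k x - v x)\<^sup>2 \<partial>M)
      = 2 * (\<integral>x. (f k x - u x)\<^sup>2 \<partial>M) + 2 * (\<integral>x. (g k x - v x)\<^sup>2 \<partial>M)" for k
    using square_integrable_diff[of "f k" M u] square_integrable_diff[of "g k" M v] int by simp
  finally show "\<forall>\<^sub>F k in sequentially. (\<integral>x. ((f k x + g k x) - (u x + v x))\<^sup>2 \<partial>M)
      \<le> 2 * (\<integral>x. (f k x - u x)\<^sup>2 \<partial>M) + 2 * (\<integral>x. (g k x - v x)\<^sup>2 \<partial>M)"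
    by simp
qed auto

lemma wiener_pair_add:
  assumes wm: "wiener_measure \<gamma>" and pairs: "wiener_pair \<gamma> f X" "wiener_pair \<gamma> g Y"
  shows "wiener_pair \<gamma> (\<lambda>x. f x + g x) (\<lambda>w. X w + Y w)"
proof -
  obtain ps where ps: "\<And>k. snd ` set (ps k) \<subseteq> {0..1}"
    "(\<lambda>k. \<integral>x. (ramp_fun (ps k) x - f x)\<^sup>2 \<partial>lebesgue_on {0..1}) \<longlonglongrightarrow> 0"
    "(\<lambda>k. \<integral>w. (ramp_var (ps k) w - X w)\<^sup>2 \<partial>completion \<gamma>) \<longlonglongrightarrow> 0"
    using pairs(1) unfolding wiener_pair_def by blast
  obtain qs where qs: "\<And>k. snd ` set (qs k) \<subseteq> {0..1}"
    "(\<lambda>k. \<integral>x. (ramp_fun (qs k) x - g x)\<^sup>2 \<partial>lebesgue_on {0..1}) \<longlonglongrightarrow> 0"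
    "(\<lambda>k. \<integral>w. (ramp_var (qs k) w - Y w)\<^sup>2 \<partial>completion \<gamma>) \<longlonglongrightarrow> 0"
    using pairs(2) unfolding wiener_pair_def by blast
  have "(\<lambda>k. \<integral>x. (ramp_fun (ps k @ qs k) x - (f x + g x))\<^sup>2 \<partial>lebesgue_on {0..1}) \<longlonglongrightarrow> 0"
    unfolding ramp_append
    by (rule L2_tendsto_add[OF _ _ _ _ _ _ _ _ ps(2) qs(2)])
      (use pairs[THEN wiener_pairD(1)] pairs[THEN wiener_pairD(2)] ramp_mgf(5)[OF wm ps(1)]
        ramp_mgf(5)[OF wm qs(1)] in simp_all)
  moreover have "(\<lambda>k. \<integral>w. (ramp_var (ps k @ qs k) w - (X w + Y w))\<^sup>2 \<partial>completion \<gamma>) \<longlonglongrightarrow> 0"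
    unfolding ramp_append
    by (rule L2_tendsto_add[OF _ _ _ _ _ _ _ _ ps(3) qs(3)])
      (use pairs[THEN wiener_pairD(3)] pairs[THEN wiener_pairD(4)] ramp_mgf(1,4)[OF wm ps(1)]
        ramp_mgf(1,4)[OF wm qs(1)] in simp_all)
  moreover have "snd ` set (ps k @ qs k) \<subseteq> {0..1}" for k
    using ps(1)[of k] qs(1)[of k] by auto
  ultimately have "\<exists>rs. (\<forall>k. snd ` set (rs k) \<subseteq> {0..1}) \<and>
      (\<lambda>k. \<integral>x. (ramp_fun (rs k) x - (f x + g x))\<^sup>2 \<partial>lebesgue_on {0..1}) \<longlonglongrightarrow> 0 \<and>
      (\<lambda>k. \<integral>w. (ramp_var (rs k) w - (X w + Y w))\<^sup>2 \<partial>completion \<gamma>) \<longlonglongrightarrow> 0"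
    by (intro exI[of _ "\<lambda>k. ps k @ qs k"]) blast
  moreover have "integrable (lebesgue_on {0..1}) (\<lambda>x. (f x + g x)\<^sup>2)"
    "integrable (completion \<gamma>) (\<lambda>w. (X w + Y w)\<^sup>2)"
    using square_integrable_add pairs[THEN wiener_pairD(1)] pairs[THEN wiener_pairD(2)]
      pairs[THEN wiener_pairD(3)] pairs[THEN wiener_pairD(4)] by blast+
  moreover have "(\<lambda>x. f x + g x) \<in> borel_measurable (lebesgue_on {0..1})"
    "(\<lambda>w. X w + Y w) \<in> borel_measurable (completion \<gamma>)"
    using pairs[THEN wiener_pairD(1)] pairs[THEN wiener_pairD(3)] by simp_all
  ultimately show ?thesis unfolding wiener_pair_def by (intro conjI)
qed

lemma wiener_pair_scale:
  assumes pair: "wiener_pair \<gamma> f X"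
  shows "wiener_pair \<gamma> (\<lambda>x. a * f x) (\<lambda>w. a * X w)"
proof -
  obtain ps where ps: "\<And>k. snd ` set (ps k) \<subseteq> {0..1}"
    "(\<lambda>k. \<integral>x. (ramp_fun (ps k) x - f x)\<^sup>2 \<partial>lebesgue_on {0..1}) \<longlonglongrightarrow> 0"
    "(\<lambda>k. \<integral>w. (ramp_var (ps k) w - X w)\<^sup>2 \<partial>completion \<gamma>) \<longlonglongrightarrow> 0"
    using pair unfolding wiener_pair_def by blast
  define qs where "qs k = map (\<lambda>(c, t). (a * c, t)) (ps k)" for k
  have "snd ` set (qs k) \<subseteq> {0..1}" for k
    using ps(1)[of k] by (force simp: qs_def)
  moreover have "(a * u - a * v)\<^sup>2 = a\<^sup>2 * (u - v)\<^sup>2" for u v :: real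
    by (simp add: power_mult_distrib flip: right_diff_distrib)
  then have "(\<lambda>k. \<integral>x. (ramp_fun (qs k) x - a * f x)\<^sup>2 \<partial>lebesgue_on {0..1}) \<longlonglongrightarrow> 0"
    "(\<lambda>k. \<integral>w. (ramp_var (qs k) w - a * X w)\<^sup>2 \<partial>completion \<gamma>) \<longlonglongrightarrow> 0"
    unfolding qs_def ramp_scale using ps(2,3)[THEN tendsto_mult_right_zero[where c = "a\<^sup>2"]]
    by simp_all
  ultimately have "\<exists>rs. (\<forall>k. snd ` set (rs k) \<subseteq> {0..1}) \<and>
      (\<lambda>k. \<integral>x. (ramp_fun (rs k) x - a * f x)\<^sup>2 \<partial>lebesgue_on {0..1}) \<longlonglongrightarrow> 0 \<and>
      (\<lambda>k. \<integral>w. (ramp_var (rs k) w - a * X w)\<^sup>2 \<partial>completion \<gamma>) \<longlonglongrightarrow> 0"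
    by (intro exI[of _ qs]) blast
  moreover have "integrable (lebesgue_on {0..1}) (\<lambda>x. (a * f x)\<^sup>2)"
    "integrable (completion \<gamma>) (\<lambda>w. (a * X w)\<^sup>2)"
    "(\<lambda>x. a * f x) \<in> borel_measurable (lebesgue_on {0..1})"
    "(\<lambda>w. a * X w) \<in> borel_measurable (completion \<gamma>)"
    using wiener_pairD[OF pair] by (auto simp: power_mult_distrib)
  ultimately show ?thesis unfolding wiener_pair_def by (intro conjI)
qed

text \<open>The norms of the approximating step functions converge, hence are bounded, and by
  \<open>ramp_mgf\<close> with \<open>a = 2\<close> so are the moments required by
  \<open>L2_tendsto_imp_exp_tendsto\<close>. Both sides of the formula then pass to the
  limit.\<close>

lemma wiener_pair_exp:
  assumes wm: "wiener_measure \<gamma>" and pair: "wiener_pair \<gamma> f X"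
  shows "integrable (completion \<gamma>) (\<lambda>w. exp (X w))"
    and "(\<integral>w. exp (X w) \<partial>completion \<gamma>) = exp ((\<integral>x. (f x)\<^sup>2 \<partial>lebesgue_on {0..1}) / 2)"
proof -
  interpret \<gamma>: prob_space \<gamma> using wiener_measureD[OF wm] by simp
  interpret prob_space "completion \<gamma>"
    by (rule prob_spaceI) (simp add: \<gamma>.emeasure_space_1)
  obtain ps where ps: "\<And>k. snd ` set (ps k) \<subseteq> {0..1}"
    "(\<lambda>k. \<integral>x. (ramp_fun (ps k) x - f x)\<^sup>2 \<partial>lebesgue_on {0..1}) \<longlonglongrightarrow> 0"
    "(\<lambda>k. \<integral>w. (ramp_var (ps k) w - X w)\<^sup>2 \<partial>completion \<gamma>) \<longlonglongrightarrow> 0"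
    using pair unfolding wiener_pair_def by blast
  define s where "s k = (\<integral>x. (ramp_fun (ps k) x)\<^sup>2 \<partial>lebesgue_on {0..1})" for k
  note mgf = ramp_mgf[OF wm ps(1)]
  have s: "s \<longlonglongrightarrow> (\<integral>x. (f x)\<^sup>2 \<partial>lebesgue_on {0..1})"
    unfolding s_def
    by (intro L2_tendsto_imp_norm_tendsto ramp_fun_measurable wiener_pairD[OF pair] mgf(5) ps(2))
  have "convergent (\<lambda>k. exp (2\<^sup>2 * s k / 2))"
    using tendsto_exp[OF tendsto_mult[OF tendsto_const s, of 2]] by (auto intro: convergentI)
  then have "Bseq (\<lambda>k. exp (2\<^sup>2 * s k / 2))" by (rule convergent_imp_Bseq)
  then obtain C where "\<forall>k. norm (exp (2\<^sup>2 * s k / 2)) \<le> C" by (rule BseqE)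
  then have C: "(\<integral>w. exp (2 * ramp_var (ps k) w) \<partial>completion \<gamma>) \<le> C" for k
    using mgf(3)[where a = 2] by (simp add: s_def)
  have lim: "integrable (completion \<gamma>) (\<lambda>w. exp (X w))"
    "(\<lambda>k. \<integral>w. exp (ramp_var (ps k) w) \<partial>completion \<gamma>) \<longlonglongrightarrow> (\<integral>w. exp (X w) \<partial>completion \<gamma>)"
    by (rule L2_tendsto_imp_exp_tendsto[where X = "\<lambda>k. ramp_var (ps k)", OF mgf(1) wiener_pairD(3)[OF pair] mgf(4)
        wiener_pairD(4)[OF pair] ps(3) mgf(2) C])+
  from lim(1) show "integrable (completion \<gamma>) (\<lambda>w. exp (X w))" .
  have "(\<lambda>k. exp (s k / 2)) \<longlonglongrightarrow> exp ((\<integral>x. (f x)\<^sup>2 \<partial>lebesgue_on {0..1}) / 2)"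
    using s by (intro tendsto_intros) auto
  with lim(2) show "(\<integral>w. exp (X w) \<partial>completion \<gamma>) = exp ((\<integral>x. (f x)\<^sup>2 \<partial>lebesgue_on {0..1}) / 2)"
    using mgf(3)[where a = 1] by (auto simp: s_def intro: LIMSEQ_unique)
qed

text \<open>The Cameron-Martin inner product at the level of derivatives, where an integrand such as
  \<open>k + a * f\<close> need not be presented as the derivative of a path.\<close>

definition l2_inner :: "(real \<Rightarrow> real) \<Rightarrow> (real \<Rightarrow> real) \<Rightarrow> real" where
  "l2_inner f g = (\<integral>x. f x * g x \<partial>lebesgue_on {0..1})"

lemma l2_inner_pair:
  assumes "wiener_pair \<gamma> f X" "wiener_pair \<gamma> g Y"
  shows "integrable (lebesgue_on {0..1}) (\<lambda>x. f x * g x)"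
  using assms by (intro Cauchy_Schwarz_integral(1) wiener_pairD)

lemma l2_inner_lin:
  assumes "wiener_pair \<gamma> f X" "wiener_pair \<gamma> g Y" "wiener_pair \<gamma> k Z"
  shows "l2_inner (\<lambda>x. f x + a * g x) k = l2_inner f k + a * l2_inner g k"
  using l2_inner_pair[OF assms(1,3)] l2_inner_pair[OF assms(2,3)]
  by (simp add: l2_inner_def distrib_right mult.assoc)

lemma l2_inner_square_add:
  assumes "wiener_pair \<gamma> f X" "wiener_pair \<gamma> g Y"
  shows "l2_inner (\<lambda>x. f x + g x) (\<lambda>x. f x + g x)
    = l2_inner f f + 2 * l2_inner f g + l2_inner g g"
proof -
  have "l2_inner (\<lambda>x. f x + g x) (\<lambda>x. f x + g x)
      = (\<integral>x. f x * f x + 2 * (f x * g x) + g x * g x \<partial>lebesgue_on {0..1})"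
    unfolding l2_inner_def by (rule Bochner_Integration.integral_cong) (auto simp: algebra_simps)
  then show ?thesis
    using l2_inner_pair[OF assms(1,1)] l2_inner_pair[OF assms] l2_inner_pair[OF assms(2,2)]
    by (simp add: l2_inner_def)
qed

text \<open>A list of factors, with repetitions in place of powers, lets each induction step gain
  exactly one factor. Integrability belongs to the claim because the next step differentiates under
  the integral and needs it for every \<open>a\<close>.\<close>

lemma wiener_pair_product_shift:
  assumes wm: "wiener_measure \<gamma>" and Y: "wiener_pair \<gamma> g Y"
    and "\<forall>(f, X)\<in>set ps. wiener_pair \<gamma> f X" and "wiener_pair \<gamma> k Z"
  shows "integrable (completion \<gamma>)
           (\<lambda>w. (\<Prod>(f, X)\<leftarrow>ps. X w) * exp (Z w + Y w - l2_inner g g / 2))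
       \<and> integrable (completion \<gamma>)
           (\<lambda>w. (\<Prod>(f, X)\<leftarrow>ps. X w + l2_inner f g) * exp (Z w + l2_inner k g))
       \<and> (\<integral>w. (\<Prod>(f, X)\<leftarrow>ps. X w) * exp (Z w + Y w - l2_inner g g / 2) \<partial>completion \<gamma>)
         = (\<integral>w. (\<Prod>(f, X)\<leftarrow>ps. X w + l2_inner f g) * exp (Z w + l2_inner k g) \<partial>completion \<gamma>)"
  using assms(3,4)
proof (induction ps arbitrary: k Z)
  case Nil
  note Z = \<open>wiener_pair \<gamma> k Z\<close>
  \<comment> \<open>Once \<open>l2_inner g g / 2\<close> is subtracted, the exponent on the left is
    \<open>l2_inner k k / 2 + l2_inner k g\<close>, as on the right.\<close>
  have "(\<integral>x. (k x + g x)\<^sup>2 \<partial>lebesgue_on {0..1}) = l2_inner k k + 2 * l2_inner k g + l2_inner g g"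
    using l2_inner_square_add[OF Z Y] by (simp add: l2_inner_def power2_eq_square)
  moreover have "(\<integral>x. (k x)\<^sup>2 \<partial>lebesgue_on {0..1}) = l2_inner k k"
    by (simp add: l2_inner_def power2_eq_square)
  ultimately show ?case
    using wiener_pair_exp[OF wm wiener_pair_add[OF wm Z Y]] wiener_pair_exp[OF wm Z]
    by (simp add: exp_add exp_diff add_divide_distrib)
next
  case (Cons p ps)
  obtain f X where p: "p = (f, X)" by (cases p)
  have X: "wiener_pair \<gamma> f X" and ps: "\<forall>(f, X)\<in>set ps. wiener_pair \<gamma> f X"
    using Cons.prems p by auto
  note Z = \<open>wiener_pair \<gamma> k Z\<close>
  define G H where "G w = (\<Prod>(f, X)\<leftarrow>ps. X w) * exp (Z w + Y w - l2_inner g g / 2)"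
    and "H w = (\<Prod>(f, X)\<leftarrow>ps. X w + l2_inner f g) * exp (Z w + l2_inner k g)" for w
  define U where "U w = X w + l2_inner f g" for w
  have shift: "wiener_pair \<gamma> (\<lambda>x. k x + a * f x) (\<lambda>w. Z w + a * X w)" for a
    by (intro wiener_pair_add wm Z wiener_pair_scale X)
  have exps: "(\<Prod>(f, X)\<leftarrow>ps. X w) * exp (Z w + a * X w + Y w - l2_inner g g / 2) = exp (a * X w) * G w"
    "(\<Prod>(f, X)\<leftarrow>ps. X w + l2_inner f g) * exp (Z w + a * X w + (l2_inner k g + a * l2_inner f g))
      = exp (a * U w) * H w" for a w
    by (simp_all add: G_def H_def U_def exp_add exp_diff algebra_simps)
  \<comment> \<open>The induction hypothesis for \<open>k + a * f\<close>. On the right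
    \<open>a\<close> also enters through \<open>l2_inner\<close>, so that it multiplies
    \<open>U\<close>, which is the shifted new factor.\<close>
  have IH: "integrable (completion \<gamma>) (\<lambda>w. exp (a * X w) * G w)"
    "integrable (completion \<gamma>) (\<lambda>w. exp (a * U w) * H w)"
    "(\<integral>w. exp (a * X w) * G w \<partial>completion \<gamma>) = (\<integral>w. exp (a * U w) * H w \<partial>completion \<gamma>)" for a
    using Cons.IH[OF ps shift[of a]] unfolding l2_inner_lin[OF Z X Y] exps by auto
  have [measurable]: "G \<in> borel_measurable (completion \<gamma>)" "H \<in> borel_measurable (completion \<gamma>)"
    using IH(1,2)[of 0, THEN borel_measurable_integrable] by auto
  have [measurable]: "X \<in> borel_measurable (completion \<gamma>)" "U \<in> borel_measurable (completion \<gamma>)"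
    using wiener_pairD(3)[OF X] by (auto simp: U_def[abs_def])
  have diff_G: "integrable (completion \<gamma>) (\<lambda>w. X w * G w)"
    "(\<lambda>n. ((\<integral>w. exp (1 / real (Suc n) * X w) * G w \<partial>completion \<gamma>) - (\<integral>w. G w \<partial>completion \<gamma>))
      * real (Suc n)) \<longlonglongrightarrow> (\<integral>w. X w * G w \<partial>completion \<gamma>)"
    by (rule integral_exp_difference_quotient; use IH(1) in simp)+
  have diff_H: "integrable (completion \<gamma>) (\<lambda>w. U w * H w)"
    "(\<lambda>n. ((\<integral>w. exp (1 / real (Suc n) * U w) * H w \<partial>completion \<gamma>) - (\<integral>w. H w \<partial>completion \<gamma>))
      * real (Suc n)) \<longlonglongrightarrow> (\<integral>w. U w * H w \<partial>completion \<gamma>)"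
    by (rule integral_exp_difference_quotient; use IH(2) in simp)+
  have "(\<integral>w. X w * G w \<partial>completion \<gamma>) = (\<integral>w. U w * H w \<partial>completion \<gamma>)"
  proof (rule LIMSEQ_unique[OF diff_G(2)])
    have "(\<integral>w. G w \<partial>completion \<gamma>) = (\<integral>w. H w \<partial>completion \<gamma>)" using IH(3)[of 0] by simp
    then show "(\<lambda>n. ((\<integral>w. exp (1 / real (Suc n) * X w) * G w \<partial>completion \<gamma>)
        - (\<integral>w. G w \<partial>completion \<gamma>)) * real (Suc n)) \<longlonglongrightarrow> (\<integral>w. U w * H w \<partial>completion \<gamma>)"
      unfolding IH(3) using diff_H(2) by (rule ssubst)
  qed
  moreover have "(\<Prod>(f, X)\<leftarrow>p # ps. X w) * exp (Z w + Y w - l2_inner g g / 2) = X w * G w"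
    "(\<Prod>(f, X)\<leftarrow>p # ps. X w + l2_inner f g) * exp (Z w + l2_inner k g) = U w * H w" for w
    by (simp_all add: p G_def H_def U_def)
  ultimately show ?case using diff_G(1) diff_H(1) by simp
qed

text \<open>Both sides are linear in the polynomial, so monomials suffice: the pair of index
  \<open>i\<close> is repeated \<open>\<alpha> i\<close> times, and the zero pair takes the place of
  \<open>k\<close> and \<open>Z\<close>.\<close>

lemma poly_eval_shift:
  assumes wm: "wiener_measure \<gamma>" and Y: "wiener_pair \<gamma> g Y"
    and X: "\<And>i. i < n \<Longrightarrow> wiener_pair \<gamma> (f i) (X i)" and "finite A"
  shows "integrable (completion \<gamma>)
      (\<lambda>w. poly_eval n A a (\<lambda>i. X i w) * exp (Y w - l2_inner g g / 2))" (is ?int1)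
    and "integrable (completion \<gamma>) (\<lambda>w. poly_eval n A a (\<lambda>i. X i w + l2_inner (f i) g))" (is ?int2)
    and "(\<integral>w. poly_eval n A a (\<lambda>i. X i w) * exp (Y w - l2_inner g g / 2) \<partial>completion \<gamma>)
      = (\<integral>w. poly_eval n A a (\<lambda>i. X i w + l2_inner (f i) g) \<partial>completion \<gamma>)" (is ?eq)
proof -
  define ps where "ps \<alpha> = concat (map (\<lambda>i. replicate (\<alpha> i) (f i, X i)) [0..<n])" for \<alpha>
  have prod: "(\<Prod>(f, X)\<leftarrow>ps \<alpha>. X w) = (\<Prod>i<n. X i w ^ \<alpha> i)"
    "(\<Prod>(f, X)\<leftarrow>ps \<alpha>. X w + l2_inner f g) = (\<Prod>i<n. (X i w + l2_inner (f i) g) ^ \<alpha> i)" for \<alpha> w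
    unfolding ps_def by (induction n) (auto simp: prod_list_replicate)
  have ps: "\<forall>(f, X)\<in>set (ps \<alpha>). wiener_pair \<gamma> f X" for \<alpha>
    using X by (auto simp: ps_def)
  have shift: "integrable (completion \<gamma>) (\<lambda>w. (\<Prod>i<n. X i w ^ \<alpha> i) * exp (Y w - l2_inner g g / 2))"
    "integrable (completion \<gamma>) (\<lambda>w. \<Prod>i<n. (X i w + l2_inner (f i) g) ^ \<alpha> i)"
    "(\<integral>w. (\<Prod>i<n. X i w ^ \<alpha> i) * exp (Y w - l2_inner g g / 2) \<partial>completion \<gamma>)
      = (\<integral>w. (\<Prod>i<n. (X i w + l2_inner (f i) g) ^ \<alpha> i) \<partial>completion \<gamma>)" for \<alpha>
    using wiener_pair_product_shift[OF wm Y ps[of \<alpha>] wiener_pair_zero]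
    unfolding prod by (simp_all add: l2_inner_def)
  have expand: "poly_eval n A a x * e = (\<Sum>\<alpha>\<in>A. a \<alpha> * ((\<Prod>i<n. x i ^ \<alpha> i) * e))" for x e
    by (simp add: poly_eval_def sum_distrib_right mult.assoc)
  show ?int1 unfolding expand using shift by (auto intro!: Bochner_Integration.integrable_sum)
  show ?int2 unfolding poly_eval_def using shift by (auto intro!: Bochner_Integration.integrable_sum)
  show ?eq unfolding expand unfolding poly_eval_def using shift
    by (simp add: Bochner_Integration.integral_sum)
qed

section \<open>Exponentials of the derivative and its adjoint\<close>

text \<open>For a fixed good \<open>w\<close> the values of \<open>G\<close> are known only on the
  line through \<open>w\<close>. The point \<open>w + s *\<^sub>R \<theta>\<close> is arbitrary on
  that line, so the derivative is again known on all of it and can be differentiated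
  further.\<close>

lemma dir_deriv_on_line:
  assumes line: "\<And>s. G (w + s *\<^sub>R \<theta>) = g s" and deriv: "(g has_real_derivative g') (at s)"
  shows "dir_deriv \<theta> G (w + s *\<^sub>R \<theta>) = g'"
proof -
  have "G (w + s *\<^sub>R \<theta> + \<epsilon> *\<^sub>R \<theta>) = g (s + \<epsilon>)" for \<epsilon>
    using line[of "s + \<epsilon>"] by (simp add: scaleR_add_left add.assoc)
  then have "dir_deriv \<theta> G (w + s *\<^sub>R \<theta>) = Lim (at 0) (\<lambda>\<epsilon>. (g (s + \<epsilon>) - g s) / \<epsilon>)"
    by (simp add: dir_deriv_def line)
  also have "\<dots> = g'"
    using deriv unfolding DERIV_def by (intro tendsto_Lim) auto
  finally show ?thesis .
qed

lemma dir_deriv_iter_poly: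
  assumes "\<And>s. F (w + s *\<^sub>R \<theta>) = poly q s"
  shows "(dir_deriv \<theta> ^^ n) F (w + s *\<^sub>R \<theta>) = poly ((pderiv ^^ n) q) s"
proof (induction n arbitrary: s)
  case (Suc n)
  show ?case
    using dir_deriv_on_line[where g = "poly ((pderiv ^^ n) q)", OF Suc poly_DERIV] by simp
qed (use assms in simp)

lemma op_exp_dir_deriv_poly:
  assumes line: "\<And>s. F (w + s *\<^sub>R \<theta>) = poly q s"
  shows "finite {n. op_exp_term (dir_deriv \<theta>) F w n \<noteq> 0}"
    and "op_exp (dir_deriv \<theta>) F w = F (w + \<theta>)"
proof -
  \<comment> \<open>The derivative of order \<open>n\<close> at 0 is the coefficient times a
    factorial, which arises as \<open>pochhammer 1 n\<close>.\<close>
  have term_eq: "op_exp_term (dir_deriv \<theta>) F w n = coeff q n" for n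
    using dir_deriv_iter_poly[of F w \<theta> q n 0, OF line]
    by (simp add: op_exp_term_def poly_0_coeff_0 coeff_higher_pderiv flip: pochhammer_fact)
  show "finite {n. op_exp_term (dir_deriv \<theta>) F w n \<noteq> 0}"
    unfolding term_eq by (rule finite_subset[of _ "{..degree q}"]) (auto intro: le_degree)
  have "op_exp (dir_deriv \<theta>) F w = (\<Sum>n\<le>degree q. coeff q n)"
    unfolding op_exp_def term_eq by (intro suminf_finite) (auto intro: coeff_eq_0)
  also have "\<dots> = poly q 1" by (simp add: poly_altdef)
  also have "\<dots> = F (w + \<theta>)" using line[of 1] by simp
  finally show "op_exp (dir_deriv \<theta>) F w = F (w + \<theta>)" .
qed

text \<open>
  The coefficient of \<open>t\<^sup>n\<close> in \<open>exp (- c t\<^sup>2 / 2)\<close> and, below, in \<open>exp (y t - c t\<^sup>2 / 2)\<close>.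
\<close>

definition gauss_coeff :: "real \<Rightarrow> nat \<Rightarrow> real" where
  "gauss_coeff c n = (if even n then (- c / 2) ^ (n div 2) / fact (n div 2) else 0)"

definition hermite_coeff :: "real \<Rightarrow> nat \<Rightarrow> real \<Rightarrow> real" where
  "hermite_coeff c n y = (\<Sum>i\<le>n. y ^ i / fact i * gauss_coeff c (n - i))"

text \<open>Compares coefficients in g' = - c t g for g(t) = exp (- c t^2 / 2).\<close>

lemma gauss_coeff_rec: "real (Suc (Suc n)) * gauss_coeff c (Suc (Suc n)) = - c * gauss_coeff c n"
proof (cases "even n")
  case True
  then obtain k where "n = 2 * k" by blast
  have "real (Suc (Suc (2 * k))) * ((- c / 2) ^ Suc k / fact (Suc k)) = - c * ((- c / 2) ^ k / fact k)"
  proof -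
    have "real (Suc (Suc (2 * k))) = 2 * real (Suc k)" by simp
    moreover have "fact (Suc k) = real (Suc k) * fact k" by simp
    ultimately show ?thesis by (simp only: power_Suc) (simp add: divide_simps del: of_nat_Suc)
  qed
  with \<open>n = 2 * k\<close> show ?thesis by (simp add: gauss_coeff_def del: of_nat_Suc fact_Suc power_Suc)
qed (simp add: gauss_coeff_def)

lemma exp_sums_real: "(\<lambda>n. x ^ n / fact n) sums exp x" for x :: real
  using exp_converges[of x] by (simp only: real_scaleR_def divide_inverse_commute)

lemma gauss_coeff_sums: "gauss_coeff c sums exp (- c / 2)"
proof -
  have "(\<lambda>k. gauss_coeff c (2 * k)) sums exp (- c / 2) \<longleftrightarrow> gauss_coeff c sums exp (- c / 2)"
    by (rule sums_mono_reindex) (auto simp: strict_mono_def gauss_coeff_def image_iff elim!: evenE)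
  moreover have "(\<lambda>k. gauss_coeff c (2 * k)) sums exp (- c / 2)"
    using exp_sums_real[of "- c / 2"] by (simp add: gauss_coeff_def)
  ultimately show ?thesis by simp
qed

text \<open>The generating function at \<open>t = 1\<close>, as the Cauchy product of two absolutely
  convergent series.\<close>

lemma hermite_coeff_sums: "(\<lambda>n. hermite_coeff c n y) sums exp (y - c / 2)"
proof -
  have "summable (\<lambda>n. norm (gauss_coeff c n))"
  proof -
    \<comment> \<open>Absolute convergence is plain convergence for the parameter
      \<open>- \<bar>c\<bar>\<close>, which makes all coefficients nonnegative.\<close>
    have "norm (gauss_coeff c n) = gauss_coeff (- \<bar>c\<bar>) n" for n
      by (simp add: gauss_coeff_def power_abs abs_divide)
    then show ?thesis using gauss_coeff_sums[of "- \<bar>c\<bar>"] by (simp add: sums_iff)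
  qed
  moreover have "summable (\<lambda>n. norm (y ^ n / fact n))"
    using sums_summable[OF exp_sums_real[of "\<bar>y\<bar>"]] by (simp add: power_abs)
  ultimately have "(\<lambda>n. hermite_coeff c n y) sums ((\<Sum>n. y ^ n / fact n) * (\<Sum>n. gauss_coeff c n))"
    unfolding hermite_coeff_def by (intro Cauchy_product_sums)
  moreover have "(\<Sum>n. y ^ n / fact n) = exp y"
    using exp_sums_real[of y] by (simp add: sums_iff)
  ultimately show ?thesis
    using gauss_coeff_sums[of c] by (simp add: sums_iff flip: exp_add)
qed

lemma hermite_coeff_0 [simp]: "hermite_coeff c 0 y = 1"
  by (simp add: hermite_coeff_def gauss_coeff_def)

lemma hermite_coeff_1: "hermite_coeff c (Suc 0) y = y"
  by (simp add: hermite_coeff_def gauss_coeff_def)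

lemma hermite_coeff_Suc:
  "hermite_coeff c (Suc n) y
    = gauss_coeff c (Suc n) + (\<Sum>i\<le>n. y ^ Suc i / fact (Suc i) * gauss_coeff c (n - i))"
  unfolding hermite_coeff_def by (subst sum.atMost_Suc_shift) simp

text \<open>Differentiation in \<open>y\<close> multiplies the generating function by
  \<open>t\<close>, which shifts the index by one.\<close>

lemma hermite_coeff_deriv:
  "((\<lambda>y. hermite_coeff c (Suc n) y) has_real_derivative hermite_coeff c n y) (at y)"
proof -
  have "((\<lambda>y. y ^ Suc i / fact (Suc i)) has_real_derivative y ^ i / fact i) (at y)" for i
    using DERIV_cdivide[OF DERIV_pow[of "Suc i" y UNIV], of "fact (Suc i)"]
    by (simp add: divide_simps del: power_Suc of_nat_Suc split: if_splits)
  then have "((\<lambda>y. gauss_coeff c (Suc n) + (\<Sum>i\<le>n. y ^ Suc i / fact (Suc i) * gauss_coeff c (n - i)))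
      has_real_derivative 0 + (\<Sum>i\<le>n. y ^ i / fact i * gauss_coeff c (n - i))) (at y)"
    by (intro DERIV_add DERIV_const DERIV_sum DERIV_cmult_right)
  then show ?thesis unfolding hermite_coeff_Suc by (simp add: hermite_coeff_def)
qed

text \<open>Compares coefficients in dE/dt = (y - c t) E, where E is the generating function as a
  formal power series in \<open>t\<close>.\<close>

lemma hermite_coeff_rec:
  "real (Suc (Suc n)) * hermite_coeff c (Suc (Suc n)) y
    = y * hermite_coeff c (Suc n) y - c * hermite_coeff c n y"
proof -
  define E where "E = fps_exp y * Abs_fps (gauss_coeff c)"
  have nth: "fps_nth E n = hermite_coeff c n y" for n
    by (simp add: E_def fps_mult_nth hermite_coeff_def atLeast0AtMost)
  have "fps_deriv (Abs_fps (gauss_coeff c)) = - (fps_const c * (fps_X * Abs_fps (gauss_coeff c)))"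
  proof (rule fps_ext)
    fix n
    \<comment> \<open>At \<open>n = 0\<close> the truncated \<open>n - 1\<close> does no harm, as
      both sides vanish there.\<close>
    show "fps_nth (fps_deriv (Abs_fps (gauss_coeff c))) n
        = fps_nth (- (fps_const c * (fps_X * Abs_fps (gauss_coeff c)))) n"
      using gauss_coeff_rec[of "n - 1" c]
      by (cases n) (auto simp: gauss_coeff_def[of _ "Suc 0"] simp del: fps_const_neg)
  qed
  then have "fps_deriv E = fps_const y * E - fps_const c * (fps_X * E)"
    by (simp add: E_def algebra_simps)
  then have "fps_nth (fps_deriv E) (Suc n) = y * fps_nth E (Suc n) - c * fps_nth E n"
    by simp
  then show ?thesis by (simp add: nth)
qed

text \<open>Along the line, differentiation lowers the index and brings out the factor
  \<open>c\<close>, and the three-term recurrence then produces the next Hermite polynomial. The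
  factor \<open>fact n\<close> cancels against the one in the exponential series.\<close>

lemma dir_deriv_adj_iter_one:
  assumes line: "\<And>s. I \<theta> (w + s *\<^sub>R \<theta>) = y + s * c"
  shows "(dir_deriv_adj I \<theta> ^^ n) (\<lambda>_. 1) (w + s *\<^sub>R \<theta>) = fact n * hermite_coeff c n (y + s * c)"
proof (induction n arbitrary: s)
  case (Suc n)
  let ?G = "(dir_deriv_adj I \<theta> ^^ n) (\<lambda>_. 1)"
  have Suc_eq: "(dir_deriv_adj I \<theta> ^^ Suc n) (\<lambda>_. 1) (w + s *\<^sub>R \<theta>)
      = - dir_deriv \<theta> ?G (w + s *\<^sub>R \<theta>) + (y + s * c) * (fact n * hermite_coeff c n (y + s * c))"
    by (simp add: dir_deriv_adj_def Suc line)
  show ?case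
  \<comment> \<open>The derivative formula starts at index 1 and the recurrence first produces index
    2, so the step from the constant function is treated apart.\<close>
  proof (cases n)
    case 0
    have "dir_deriv \<theta> ?G (w + s *\<^sub>R \<theta>) = 0"
      by (rule dir_deriv_on_line[where g = "\<lambda>_. 1"]) (simp_all add: 0)
    then show ?thesis unfolding Suc_eq using hermite_coeff_1[of c "y + s * c"] by (simp add: 0)
  next
    case (Suc m)
    have "((\<lambda>s. fact n * hermite_coeff c n (y + s * c)) has_real_derivative
        fact n * (hermite_coeff c m (y + s * c) * c)) (at s)"
      unfolding Suc
      by (intro DERIV_cmult DERIV_chain2[OF hermite_coeff_deriv]) (auto intro!: derivative_eq_intros)
    then have "dir_deriv \<theta> ?G (w + s *\<^sub>R \<theta>) = fact n * (hermite_coeff c m (y + s * c) * c)"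
      by (rule dir_deriv_on_line[where g = "\<lambda>s. fact n * hermite_coeff c n (y + s * c)", OF Suc.IH])
    then have "(dir_deriv_adj I \<theta> ^^ Suc n) (\<lambda>_. 1) (w + s *\<^sub>R \<theta>)
        = fact n * ((y + s * c) * hermite_coeff c n (y + s * c) - c * hermite_coeff c m (y + s * c))"
      unfolding Suc_eq by (simp add: algebra_simps)
    also have "\<dots> = fact n * (real (Suc n) * hermite_coeff c (Suc n) (y + s * c))"
      using hermite_coeff_rec[of m c "y + s * c"] Suc by simp
    finally show ?thesis by simp
  qed
qed simp

lemma op_exp_dir_deriv_adj_one:
  assumes "\<And>s. I \<theta> (w + s *\<^sub>R \<theta>) = y + s * c"
  shows "summable (op_exp_term (dir_deriv_adj I \<theta>) (\<lambda>_. 1) w)"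
    and "op_exp (dir_deriv_adj I \<theta>) (\<lambda>_. 1) w = exp (y - c / 2)"
proof -
  have "op_exp_term (dir_deriv_adj I \<theta>) (\<lambda>_. 1) w = (\<lambda>n. hermite_coeff c n y)"
    using dir_deriv_adj_iter_one[of I \<theta> w y c _ 0, OF assms] by (auto simp: op_exp_term_def)
  then show "summable (op_exp_term (dir_deriv_adj I \<theta>) (\<lambda>_. 1) w)"
    "op_exp (dir_deriv_adj I \<theta>) (\<lambda>_. 1) w = exp (y - c / 2)"
    using hermite_coeff_sums[of c y] by (auto simp: op_exp_def sums_iff)
qed

section \<open>Lines inside the Cameron-Martin space\<close>

lemma scaleR_path_eq: "apply_bcontfun (s *\<^sub>R \<theta>) = (\<lambda>t. s * apply_bcontfun \<theta> t)" for \<theta> :: path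
  by auto

lemma zero_wiener_space: "0 \<in> wiener_space"
  by (simp add: wiener_space_def)

lemma wiener_space_line:
  assumes "w \<in> wiener_space" "\<theta> \<in> wiener_space"
  shows "w + s *\<^sub>R \<theta> \<in> wiener_space"
proof -
  have const: "w t = w u" "\<theta> t = \<theta> u" if "t \<le> 0 \<and> u = 0 \<or> t \<ge> 1 \<and> u = 1" for t u
    using assms that unfolding wiener_space_def by blast+
  have "w 0 = 0" "\<theta> 0 = 0" using assms unfolding wiener_space_def by blast+
  have "(w + s *\<^sub>R \<theta>) t = (w + s *\<^sub>R \<theta>) u" if "t \<le> 0 \<and> u = 0 \<or> t \<ge> 1 \<and> u = 1" for t u
    by (simp add: const[OF that])
  moreover have "(w + s *\<^sub>R \<theta>) 0 = 0" by (simp add: \<open>w 0 = 0\<close> \<open>\<theta> 0 = 0\<close>)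
  ultimately show ?thesis unfolding wiener_space_def by blast
qed

lemma absolutely_continuous_path_scale:
  assumes "absolutely_continuous_path h"
  shows "absolutely_continuous_path (\<lambda>t. s * h t)"
  unfolding absolutely_continuous_path_def
proof (intro allI impI)
  fix \<epsilon> :: real assume "\<epsilon> > 0"
  \<comment> \<open>The summand 1 keeps the quotient meaningful for \<open>s = 0\<close>.\<close>
  then have "\<epsilon> / (\<bar>s\<bar> + 1) > 0" by (simp add: add_nonneg_pos)
  from assms[unfolded absolutely_continuous_path_def, rule_format, OF this]
  obtain \<delta> where \<delta>: "\<delta> > 0" "\<And>(n::nat) a b.
        (\<forall>i<n. 0 \<le> a i \<and> a i \<le> b i \<and> b i \<le> 1) \<Longrightarrow>
        disjoint_family_on (\<lambda>i. {a i<..<b i}) {..<n} \<Longrightarrow> (\<Sum>i<n. b i - a i) < \<delta> \<Longrightarrow>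
        (\<Sum>i<n. \<bar>h (b i) - h (a i)\<bar>) < \<epsilon> / (\<bar>s\<bar> + 1)"
    by blast
  have "(\<Sum>i<n. \<bar>s * h (b i) - s * h (a i)\<bar>) < \<epsilon>"
    if "(\<forall>i<n. 0 \<le> a i \<and> a i \<le> b i \<and> b i \<le> 1) \<and>
        disjoint_family_on (\<lambda>i. {a i<..<b i}) {..<n} \<and> (\<Sum>i<n. b i - a i) < \<delta>"
    for n :: nat and a b
  proof -
    have "(\<Sum>i<n. \<bar>s * h (b i) - s * h (a i)\<bar>) = \<bar>s\<bar> * (\<Sum>i<n. \<bar>h (b i) - h (a i)\<bar>)"
      by (simp add: sum_distrib_left flip: right_diff_distrib abs_mult)
    also have "\<dots> \<le> (\<bar>s\<bar> + 1) * (\<Sum>i<n. \<bar>h (b i) - h (a i)\<bar>)"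
      by (intro mult_right_mono sum_nonneg) auto
    also have "\<dots> < (\<bar>s\<bar> + 1) * (\<epsilon> / (\<bar>s\<bar> + 1))"
    proof (rule mult_strict_left_mono)
      show "(\<Sum>i<n. \<bar>h (b i) - h (a i)\<bar>) < \<epsilon> / (\<bar>s\<bar> + 1)"
        using that by (intro \<delta>(2)) blast+
    qed simp
    also have "\<dots> = \<epsilon>" by (simp add: add_nonneg_eq_0_iff)
    finally show ?thesis .
  qed
  with \<delta>(1) show "\<exists>\<delta>>0. \<forall>(n::nat) a b.
        (\<forall>i<n. 0 \<le> a i \<and> a i \<le> b i \<and> b i \<le> 1) \<and>
        disjoint_family_on (\<lambda>i. {a i<..<b i}) {..<n} \<and> (\<Sum>i<n. b i - a i) < \<delta> \<longrightarrow>
        (\<Sum>i<n. \<bar>s * h (b i) - s * h (a i)\<bar>) < \<epsilon>"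
    by blast
qed

text \<open>Applying the convention along a line requires every multiple of \<open>\<theta>\<close>
  to be an admissible shift. The derivative of the multiple is identified only where
  \<open>\<theta>\<close> is differentiable, so the identities are almost everywhere ones.\<close>

lemma cameron_martin_scale:
  assumes \<theta>: "\<theta> \<in> cameron_martin"
  shows "s *\<^sub>R \<theta> \<in> cameron_martin"
    and "h \<in> cameron_martin \<Longrightarrow> cm_inner h (s *\<^sub>R \<theta>) = s * cm_inner h \<theta>"
proof -
  interpret complete_measure "lebesgue_on {0..1::real}"
    by (rule complete_measure_lebesgue_on) simp
  have diff: "AE t in lebesgue_on {0..1}. apply_bcontfun \<theta> field_differentiable (at t)"
    and [measurable]: "deriv \<theta> \<in> borel_measurable (lebesgue_on {0..1})"
    and sq: "integrable (lebesgue_on {0..1}) (\<lambda>t. (deriv \<theta> t)\<^sup>2)"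
    using \<theta> by (auto simp: cameron_martin_def)
  have diff_s: "AE t in lebesgue_on {0..1}. apply_bcontfun (s *\<^sub>R \<theta>) field_differentiable (at t)"
    using diff unfolding scaleR_path_eq
    by eventually_elim (intro field_differentiable_mult field_differentiable_const)
  have deriv_s: "AE t in lebesgue_on {0..1}. s * deriv \<theta> t = deriv (s *\<^sub>R \<theta>) t"
    using diff unfolding scaleR_path_eq by eventually_elim (simp add: deriv_cmult)
  have meas_s [measurable]: "deriv (s *\<^sub>R \<theta>) \<in> borel_measurable (lebesgue_on {0..1})"
    by (rule borel_measurable_cong_AE_complete[OF _ deriv_s]) measurable
  have "integrable (lebesgue_on {0..1}) (\<lambda>t. (deriv (s *\<^sub>R \<theta>) t)\<^sup>2)"
  proof (rule integral_cong_AE_complete(1))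
    show "integrable (lebesgue_on {0..1}) (\<lambda>t. s\<^sup>2 * (deriv \<theta> t)\<^sup>2)" using sq by simp
    show "AE t in lebesgue_on {0..1}. (deriv (s *\<^sub>R \<theta>) t)\<^sup>2 = s\<^sup>2 * (deriv \<theta> t)\<^sup>2"
      using deriv_s by eventually_elim (simp flip: power_mult_distrib)
  qed
  moreover have "s *\<^sub>R \<theta> \<in> wiener_space"
  proof -
    have "\<theta> \<in> wiener_space" using \<theta> unfolding cameron_martin_def by blast
    then show ?thesis using wiener_space_line[of 0 \<theta> s] by (simp add: zero_wiener_space)
  qed
  moreover have "absolutely_continuous_path (s *\<^sub>R \<theta>)"
  proof -
    have "absolutely_continuous_path \<theta>" using \<theta> unfolding cameron_martin_def by blast
    from absolutely_continuous_path_scale[OF this] show ?thesis unfolding scaleR_path_eq .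
  qed
  ultimately show "s *\<^sub>R \<theta> \<in> cameron_martin"
    using diff_s meas_s unfolding cameron_martin_def by (intro CollectI conjI)
  assume "h \<in> cameron_martin"
  then have [measurable]: "deriv h \<in> borel_measurable (lebesgue_on {0..1})"
    by (simp add: cameron_martin_def)
  have "cm_inner h (s *\<^sub>R \<theta>) = (\<integral>t. s * (deriv h t * deriv \<theta> t) \<partial>lebesgue_on {0..1})"
    unfolding cm_inner_def
  proof (rule integral_cong_AE)
    show "AE t in lebesgue_on {0..1}. deriv h t * deriv (s *\<^sub>R \<theta>) t = s * (deriv h t * deriv \<theta> t)"
      using deriv_s by eventually_elim simp
  qed measurable
  then show "cm_inner h (s *\<^sub>R \<theta>) = s * cm_inner h \<theta>"
    by (simp add: cm_inner_def)
qed

lemma poly_eval_line: "\<exists>q. \<forall>s. poly_eval n A a (\<lambda>i. x i + s * c i) = poly q s"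
proof (intro exI allI)
  show "poly_eval n A a (\<lambda>i. x i + s * c i)
      = poly (\<Sum>\<alpha>\<in>A. smult (a \<alpha>) (\<Prod>i<n. [:x i, c i:] ^ \<alpha> i)) s" for s
    by (simp add: poly_eval_def poly_sum poly_prod)
qed

lemma wiener_pair_wiener_integral_map:
  assumes "wiener_integral_map \<gamma> I" "h \<in> cameron_martin"
  shows "wiener_pair \<gamma> (deriv h) (I h)"
  using assms by (intro wiener_pair_deriv) (auto simp: wiener_integral_map_def)

text \<open>In the convention the quantifier over shifts stands inside the almost everywhere
  statement, so one null set serves the uncountably many \<open>s\<close>.\<close>

lemma AE_wiener_integral_line:
  assumes I: "wiener_integral_map \<gamma> I" and h: "h \<in> cameron_martin" and \<theta>: "\<theta> \<in> cameron_martin"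
  shows "AE w in completion \<gamma>. \<forall>s. I h (w + s *\<^sub>R \<theta>) = I h w + s * cm_inner h \<theta>"
proof -
  have "AE w in completion \<gamma>. \<forall>\<theta>\<in>cameron_martin. I h (w + \<theta>) = I h w + cm_inner h \<theta>"
    using I h unfolding wiener_integral_map_def by blast
  then show ?thesis
    by eventually_elim (simp add: cameron_martin_scale[OF \<theta>] h)
qed

text \<open>Finiteness, summability and integrability accompany the equations so that none of these
  rests on a default value of a sum or an integral.\<close>

theorem corollary2p8:
  fixes \<gamma> :: "path measure" and I :: "path \<Rightarrow> path \<Rightarrow> real"
    and \<theta> :: path and F :: "path \<Rightarrow> real"
  assumes "wiener_measure \<gamma>"
    and "wiener_integral_map \<gamma> I"
    and "\<theta> \<in> cameron_martin"
    and "F \<in> polynomial_functionals I"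
  shows
    "((\<integral>w. F (w + \<theta>) \<partial>completion \<gamma>)
         = (\<integral>w. op_exp (dir_deriv \<theta>) F w \<partial>completion \<gamma>)
      \<and> (\<integral>w. op_exp (dir_deriv \<theta>) F w \<partial>completion \<gamma>)
         = (\<integral>w. F w * op_exp (dir_deriv_adj I \<theta>) (\<lambda>_. 1) w \<partial>completion \<gamma>)
      \<and> (\<integral>w. F w * op_exp (dir_deriv_adj I \<theta>) (\<lambda>_. 1) w \<partial>completion \<gamma>)
         = (\<integral>w. F w * exp (I \<theta> w - (1 / 2) * (\<integral>t. (deriv \<theta> t)\<^sup>2 \<partial>lebesgue_on {0..1}))
              \<partial>completion \<gamma>))
     \<and> (AE w in completion \<gamma>. finite {n. op_exp_term (dir_deriv \<theta>) F w n \<noteq> 0})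
     \<and> (AE w in completion \<gamma>. summable (op_exp_term (dir_deriv_adj I \<theta>) (\<lambda>_. 1) w))
     \<and> integrable (completion \<gamma>) (\<lambda>w. F (w + \<theta>))
     \<and> integrable (completion \<gamma>) (\<lambda>w. op_exp (dir_deriv \<theta>) F w)
     \<and> integrable (completion \<gamma>) (\<lambda>w. F w * op_exp (dir_deriv_adj I \<theta>) (\<lambda>_. 1) w)
     \<and> integrable (completion \<gamma>)
          (\<lambda>w. F w * exp (I \<theta> w - (1 / 2) * (\<integral>t. (deriv \<theta> t)\<^sup>2 \<partial>lebesgue_on {0..1})))"
proof -
  note wm = assms(1) and I = assms(2) and \<theta> = assms(3)
  obtain n h A a where h: "\<And>i. i < n \<Longrightarrow> h i \<in> cameron_martin" and A: "finite A"
    and F: "\<And>w. w \<in> wiener_space \<Longrightarrow> F w = poly_eval n A a (\<lambda>i. I (h i) w)"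
    using assms(4) unfolding polynomial_functionals_def by blast
  define c where "c = cm_inner \<theta> \<theta>"
  have c: "(\<integral>t. (deriv \<theta> t)\<^sup>2 \<partial>lebesgue_on {0..1}) = c"
    by (simp add: c_def cm_inner_def power2_eq_square)
  have l2_inner_deriv: "l2_inner (deriv h1) (deriv h2) = cm_inner h1 h2" for h1 h2 :: path
    by (simp add: l2_inner_def cm_inner_def)
  \<comment> \<open>\<open>W\<close> is the density. Each of the four integrands is almost
    everywhere equal to \<open>S\<close> or to the product of \<open>P\<close> and \<open>W\<close>,
    whose integrability comes from \<open>poly_eval_shift\<close>.\<close>
  define W where "W w = exp (I \<theta> w - c / 2)" for w
  define P where "P w = poly_eval n A a (\<lambda>i. I (h i) w)" for w
  define S where "S w = poly_eval n A a (\<lambda>i. I (h i) w + cm_inner (h i) \<theta>)" for w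
  have shift: "integrable (completion \<gamma>) (\<lambda>w. P w * W w)" "integrable (completion \<gamma>) S"
    "(\<integral>w. P w * W w \<partial>completion \<gamma>) = (\<integral>w. S w \<partial>completion \<gamma>)"
    using poly_eval_shift[where f = "\<lambda>i. deriv (h i)" and X = "\<lambda>i. I (h i)" and n = n and a = a,
        OF wm wiener_pair_wiener_integral_map[OF I \<theta>] wiener_pair_wiener_integral_map[OF I h] A]
    unfolding l2_inner_deriv P_def W_def S_def[abs_def] c_def by simp_all
  \<comment> \<open>Only finitely many \<open>h i\<close> occur in \<open>F\<close>, so the union of
    the exceptional sets is null.\<close>
  have ae: "AE w in completion \<gamma>.
      w \<in> wiener_space \<and> (\<forall>s. I \<theta> (w + s *\<^sub>R \<theta>) = I \<theta> w + s * c) \<and>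
      (\<forall>i\<in>{..<n}. \<forall>s. I (h i) (w + s *\<^sub>R \<theta>) = I (h i) w + s * cm_inner (h i) \<theta>)"
    using AE_wiener_integral_line[OF I \<theta> \<theta>] AE_wiener_integral_line[OF I h \<theta>]
      AE_space[of "completion \<gamma>"]
    by (intro AE_conjI AE_finite_allI) (auto simp: c_def wiener_measureD(2)[OF wm])
  \<comment> \<open>The polynomial form of \<open>F\<close> is given on the Wiener space only, so
    the line has to stay inside it.\<close>
  have "\<theta> \<in> wiener_space" using \<theta> unfolding cameron_martin_def by blast
  then have line_space: "w + s *\<^sub>R \<theta> \<in> wiener_space" if "w \<in> wiener_space" for w s
    using wiener_space_line that by blast
  have pointwise: "AE w in completion \<gamma>. F (w + \<theta>) = S w \<and> op_exp (dir_deriv \<theta>) F w = S w \<and>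
      F w * op_exp (dir_deriv_adj I \<theta>) (\<lambda>_. 1) w = P w * W w \<and> F w * W w = P w * W w \<and>
      finite {n. op_exp_term (dir_deriv \<theta>) F w n \<noteq> 0} \<and>
      summable (op_exp_term (dir_deriv_adj I \<theta>) (\<lambda>_. 1) w)"
    using ae
  proof eventually_elim
    case (elim w)
    obtain q where q: "\<And>s. poly_eval n A a (\<lambda>i. I (h i) w + s * cm_inner (h i) \<theta>) = poly q s"
      using poly_eval_line[of n A a "\<lambda>i. I (h i) w" "\<lambda>i. cm_inner (h i) \<theta>"] by blast
    have line: "F (w + s *\<^sub>R \<theta>) = poly q s" for s
      unfolding q[symmetric] using elim line_space by (simp add: F poly_eval_def)
    have "F (w + \<theta>) = S w"
      using line[of 1] q[of 1] by (simp add: S_def)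
    moreover have "F w = P w" using F elim by (simp add: P_def)
    moreover have "I \<theta> (w + s *\<^sub>R \<theta>) = I \<theta> w + s * c" for s using elim by blast
    note op_exp_dir_deriv_adj_one[of I \<theta> w, OF this]
    ultimately show ?case
      using op_exp_dir_deriv_poly[of F w \<theta>, OF line] by (simp add: W_def)
  qed
  have W: "exp (I \<theta> w - (1 / 2) * (\<integral>t. (deriv \<theta> t)\<^sup>2 \<partial>lebesgue_on {0..1})) = W w" for w
    by (simp add: W_def c)
  have ae_eq: "AE w in completion \<gamma>. F (w + \<theta>) = S w"
    "AE w in completion \<gamma>. op_exp (dir_deriv \<theta>) F w = S w"
    "AE w in completion \<gamma>. F w * op_exp (dir_deriv_adj I \<theta>) (\<lambda>_. 1) w = P w * W w"
    "AE w in completion \<gamma>. F w * W w = P w * W w"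
    "AE w in completion \<gamma>. finite {n. op_exp_term (dir_deriv \<theta>) F w n \<noteq> 0}"
    "AE w in completion \<gamma>. summable (op_exp_term (dir_deriv_adj I \<theta>) (\<lambda>_. 1) w)"
    using pointwise unfolding AE_conj_iff by blast+
  show ?thesis
    unfolding W
    using completion.integral_cong_AE_complete[OF shift(2) ae_eq(1)]
      completion.integral_cong_AE_complete[OF shift(2) ae_eq(2)]
      completion.integral_cong_AE_complete[OF shift(1) ae_eq(3)]
      completion.integral_cong_AE_complete[OF shift(1) ae_eq(4)] shift(3) ae_eq(5,6)
    by (intro conjI) simp_all
qed

end
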